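(* Let $\bm A\in\mathbb R^{n_x\times n_x}$, $\bm B\in\mathbb R^{n_x\times n_u}$, $\bm D\in\mathbb R^{n_x\times n_w}$, $\bm A_y\in\mathbb R^{n_y\times n_x}$, $\bm E_x\in\mathbb R^{n_x\times n_m}$, $\bm E_y\in\mathbb R^{n_y\times n_\delta}$, let $\bm\Gamma_0,\bm\Gamma_1\in\mathbb R^{n_x\times n_x}$ be symmetric positive definite, and let $\gamma_{\mathcal W}=\sqrt{\gamma^*}$ be a given $\mathcal W_\infty$-index. Assume that there exist matrices $\bm S,\bm W\in\mathbb R^{n_x\times n_x}$, $\bm B_s\in\mathbb R^{n_x\times n_y}$, $\bm C_s\in\mathbb R^{n_u\times n_x}$, $\bm D_f\in\mathbb R^{n_u\times n_y}$ and $\bm N\in\mathbb R^{n_m\times n_m}$ satisfying the semidefinite program $$\min_{\bm S,\bm W,\bm B_s,\bm C_s,\bm D_f}\ \mathrm{tr}\{\bm N\}$$ subject to $$\begin{bmatrix}\bm N & \bm E_x'\\ \bm E_x & \bm W\end{bmatrix}>0,\qquad \begin{bmatrix}\bm S & \bm I\\ \bm I & \bm W'\end{bmatrix}>0,\qquad \begin{bmatrix}\bm\Psi_1 & * & *\\ \bm 0 & \bm\Phi_3 & *\\ \bm\Psi_4 & \bm\Phi_5 & \bm\Psi_6\end{bmatrix}<0,$$ (that is, matrices satisfying these constraints), where $$\bm\Psi_1=\bm A\bm S+\bm B\bm C_s+(\bm A\bm S+\bm B\bm C_s)',\qquad \bm\Phi_3=\bm A'\bm W'+\bm A_y'\bm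 B_s'+\bm W\bm A+\bm B_s\bm A_y,$$ $$\bm\Psi_4'=\begin{bmatrix}\bm D & \bm S & (\bm A\bm S+\bm B\bm C_s)'\end{bmatrix},\qquad \bm\Phi_5'=\begin{bmatrix}\bm W\bm D & \bm I & (\bm A+\bm B\bm D_f\bm A_y)'\end{bmatrix},$$ $$\bm\Psi_6=\begin{bmatrix}-\gamma^*\bm I & \bm 0 & \bm D'\\ \bm 0 & -\bm\Gamma_0^{-1} & \bm 0\\ \bm D & \bm 0 & -\bm\Gamma_1^{-1}\end{bmatrix}.$$ Let $\bm T\in\mathbb R^{n_x\times n_x}$ be an arbitrarily chosen symmetric positive definite matrix and set $$\bm A_f=\bm T(\bm S-\bm W^{-1})^{-1}\Big(\bm A\bm S+\bm B\bm C_s-(\bm B\bm D_f-\bm W^{-1}\bm B_s)\bm A_y\bm S+(\bm W^{-1})'(\bm A+\bm B\bm D_f\bm A_y)'\Big)\bm T^{-1},$$ $$\bm B_f=\bm T(\bm S-\bm W^{-1})^{-1}(\bm B\bm D_f-\bm W^{-1}\bm B_s),\qquad \bm C_f=(\bm C_s-\bm D_f\bm A_y\bm S)\bm T^{-1}.$$ Consider the stochastic system $d\bm x=(\bm A\bm x+\bm B\bm u+\bm D\bm w)\,dt+\bm E_x\,dm$, with measurement $\bm y=\bm A_y\bm x+\bm E_y\,d\delta$, in closed loop with the dynamic output-feedback control law $\bm u=\bm C_f\bm x_f+\bm D_f\bm y$, $d\bm x_f=(\bm A_f\bm x_f+\bm B_f\bm y)\,dt$, and let $\bm{\mathcal X}=[\bm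 x'\ \ \bm x_f']'$. Then the following properties hold: 1) There exist a quadratic function $v(\bm{\mathcal X})=\tfrac12\bm{\mathcal X}'\bm P\bm{\mathcal X}$ with $\bm P$ symmetric positive definite and constants $\alpha,\beta\in\mathbb R_{>0}$ such that the closed-loop trajectories satisfy the stochastic dissipation inequality $$\mathcal E\{dv\}\le\big(-\alpha\|\bm{\mathcal X}\|^2+\beta\|\bm w\|^2+\mathrm{tr}(\bm N)\big)\,dt .$$ 2) There exist constants $c_1,c_2\in\mathbb R_{>0}$ such that the closed-loop system is mean-square ultimately bounded, with $$\limsup_{t\to\infty}\mathcal E\{\|\bm{\mathcal X}(t)\|_2^2\}\le\frac{c_1\|\bm w\|_{\mathcal L_\infty}^2+\mathrm{tr}(\bm N)}{c_2}.$$
   Context: Primes denote transposes; $\bm I$ and $\bm 0$ are identity and zero matrices of appropriate dimensions; $>0$ ($<0$) for matrices means symmetric positive (negative) definite; $*$ denotes blocks determined by symmetry. Here $t\in[0,\infty)$, $\bm x$ is the $\mathbb R^{n_x}$-valued state, $\bm u$ the $\mathbb R^{n_u}$-valued control, $\bm w$ the $\mathbb R^{n_w}$-valued disturbance, $\bm x_f$ the $\mathbb R^{n_x}$-valued controller state, and all are $\mathcal F_t$-measurable. The processes $m(t)\in\mathbb R^{n_m}$ and $\delta(t)\in\mathbb R^{n_\delta}$ are vectors of standard Brownian motions on a complete filtered probability space $(\Omega,\mathcal F,\{\mathcal F_t\}_{t\ge0},\mathbb P)$, and $\mathcal E\{\bm x(0)\}=\bm x_0\in\mathbb R^{n_x}$,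 with $\bm{\mathcal X}(0)$ having finite second moment. The differentials obey the formal Itô rules $dt\,dt=dt\,dm=dm\,dt=0$, $dm\,dm=dt$, and products of $dt$ with $d\delta$ are likewise zero, so the measurement noise (which enters only multiplied by $dt$) drops out and the closed-loop system is the Itô equation $$d\bm{\mathcal X}=(\bm A_c\bm{\mathcal X}+\bm D_c\bm w)\,dt+\bm E_c\,dm,$$ $$\bm A_c=\begin{bmatrix}\bm A+\bm B\bm D_f\bm A_y & \bm B\bm C_f\\ \bm B_f\bm A_y & \bm A_f\end{bmatrix},\quad \bm D_c=\begin{bmatrix}\bm D\\ \bm 0\end{bmatrix},\quad \bm E_c=\begin{bmatrix}\bm E_x\\ \bm 0\end{bmatrix}.$$ $\mathcal E\{dv\}$ is the conditional expectation given $\mathcal F_t$ of the Itô differential of $v(\bm{\mathcal X}(t))$, i.e. its drift part (coefficient of $dt$). $\|\bm w\|_{\mathcal L_\infty}$ is the essential supremum norm of $\bm w$; in property 2 the disturbance is bounded and the constants $c_1,c_2$ do not depend on $\bm w$ or on the initial condition. *)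

theory Defs
  imports "HOL-Probability.Probability"
begin

definition posdef :: "real^'n^'n \<Rightarrow> bool" where
  "posdef A \<longleftrightarrow> transpose A = A \<and> (\<forall>x. x \<noteq> 0 \<longrightarrow> 0 < x \<bullet> (A *v x))"

definition negdef :: "real^'n^'n \<Rightarrow> bool" where
  "negdef A \<longleftrightarrow> transpose A = A \<and> (\<forall>x. x \<noteq> 0 \<longrightarrow> x \<bullet> (A *v x) < 0)"

text \<open>Since a matrix is a vector of rows, \<open>vstack\<close> stacks both vectors and matrices.\<close>

definition vstack :: "'a^'p \<Rightarrow> 'a^'q \<Rightarrow> 'a^('p + 'q)" where
  "vstack a b = (\<chi> i. case i of Inl p \<Rightarrow> a $ p | Inr q \<Rightarrow> b $ q)"

definition hstack :: "'a^'m^'p \<Rightarrow> 'a^'n^'p \<Rightarrow> 'a^('m + 'n)^'p" where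
  "hstack A B = (\<chi> i. vstack (A $ i) (B $ i))"

definition block2 ::
  "'a^'m^'p \<Rightarrow> 'a^'n^'p \<Rightarrow>
   'a^'m^'q \<Rightarrow> 'a^'n^'q \<Rightarrow> 'a^('m + 'n)^('p + 'q)" where
  "block2 A11 A12
          A21 A22 = vstack (hstack A11 A12) (hstack A21 A22)"

definition block3 ::
  "'a^'l^'p \<Rightarrow> 'a^'m^'p \<Rightarrow> 'a^'n^'p \<Rightarrow>
   'a^'l^'q \<Rightarrow> 'a^'m^'q \<Rightarrow> 'a^'n^'q \<Rightarrow>
   'a^'l^'r \<Rightarrow> 'a^'m^'r \<Rightarrow> 'a^'n^'r \<Rightarrow> 'a^('l + ('m + 'n))^('p + ('q + 'r))" where
  "block3 A11 A12 A13
          A21 A22 A23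
          A31 A32 A33 =
     vstack (hstack A11 (hstack A12 A13))
            (vstack (hstack A21 (hstack A22 A23))
                    (hstack A31 (hstack A32 A33)))"

definition Psi1 :: "real^'x^'x \<Rightarrow> real^'u^'x \<Rightarrow> real^'x^'x \<Rightarrow> real^'x^'u \<Rightarrow> real^'x^'x" where
  "Psi1 A B S Cs = A ** S + B ** Cs + transpose (A ** S + B ** Cs)"

definition Phi3 :: "real^'x^'x \<Rightarrow> real^'x^'y \<Rightarrow> real^'x^'x \<Rightarrow> real^'y^'x \<Rightarrow> real^'x^'x" where
  "Phi3 A Ay W Bs =
     transpose A ** transpose W + transpose Ay ** transpose Bs + W ** A + Bs ** Ay"

definition Psi4 :: "real^'x^'x \<Rightarrow> real^'u^'x \<Rightarrow> real^'w^'x \<Rightarrow> real^'x^'x \<Rightarrow> real^'x^'u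
    \<Rightarrow> real^'x^('w + ('x + 'x))" where
  "Psi4 A B D S Cs = transpose (hstack D (hstack S (transpose (A ** S + B ** Cs))))"

definition Phi5 :: "real^'x^'x \<Rightarrow> real^'u^'x \<Rightarrow> real^'w^'x \<Rightarrow> real^'x^'y \<Rightarrow> real^'x^'x \<Rightarrow> real^'y^'u
    \<Rightarrow> real^'x^('w + ('x + 'x))" where
  "Phi5 A B D Ay W Df =
     transpose (hstack (W ** D) (hstack (mat 1) (transpose (A + B ** Df ** Ay))))"

definition Psi6 :: "real^'w^'x \<Rightarrow> real \<Rightarrow> real^'x^'x \<Rightarrow> real^'x^'x
    \<Rightarrow> real^('w + ('x + 'x))^('w + ('x + 'x))" where
  "Psi6 D g \<Gamma>0 \<Gamma>1 =
     block3 (- (g *\<^sub>R mat 1)) 0                  (transpose D)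
            0                  (- matrix_inv \<Gamma>0) 0
            D                  0                  (- matrix_inv \<Gamma>1)"

definition sdp_feasible ::
  "real^'x^'x \<Rightarrow> real^'u^'x \<Rightarrow> real^'w^'x \<Rightarrow> real^'x^'y \<Rightarrow> real^'m^'x \<Rightarrow>
   real^'x^'x \<Rightarrow> real^'x^'x \<Rightarrow> real \<Rightarrow>
   real^'x^'x \<Rightarrow> real^'x^'x \<Rightarrow> real^'y^'x \<Rightarrow> real^'x^'u \<Rightarrow> real^'y^'u \<Rightarrow> real^'m^'m \<Rightarrow> bool" where
  "sdp_feasible A B D Ay E\<^sub>x \<Gamma>0 \<Gamma>1 g S W Bs Cs Df N \<longleftrightarrow>
     posdef (block2 N  (transpose E\<^sub>x)
                    E\<^sub>x W) \<and>
     posdef (block2 S       (mat 1)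
                    (mat 1) (transpose W)) \<and>
     negdef (block3
       (Psi1 A B S Cs)   0                      (transpose (Psi4 A B D S Cs))
       0                 (Phi3 A Ay W Bs)       (transpose (Phi5 A B D Ay W Df))
       (Psi4 A B D S Cs) (Phi5 A B D Ay W Df)   (Psi6 D g \<Gamma>0 \<Gamma>1))"

definition controller_Af ::
  "real^'x^'x \<Rightarrow> real^'u^'x \<Rightarrow> real^'x^'y \<Rightarrow> real^'x^'x \<Rightarrow> real^'x^'x \<Rightarrow>
   real^'y^'x \<Rightarrow> real^'x^'u \<Rightarrow> real^'y^'u \<Rightarrow> real^'x^'x \<Rightarrow> real^'x^'x" where
  "controller_Af A B Ay S W Bs Cs Df T =
     T ** matrix_inv (S - matrix_inv W) **
     (A ** S + B ** Cs - (B ** Df - matrix_inv W ** Bs) ** Ay ** S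
        + transpose (matrix_inv W) ** transpose (A + B ** Df ** Ay)) **
     matrix_inv T"

definition controller_Bf ::
  "real^'u^'x \<Rightarrow> real^'x^'x \<Rightarrow> real^'x^'x \<Rightarrow> real^'y^'x \<Rightarrow> real^'y^'u \<Rightarrow> real^'x^'x
    \<Rightarrow> real^'y^'x" where
  "controller_Bf B S W Bs Df T =
     T ** matrix_inv (S - matrix_inv W) ** (B ** Df - matrix_inv W ** Bs)"

definition controller_Cf ::
  "real^'x^'y \<Rightarrow> real^'x^'x \<Rightarrow> real^'x^'u \<Rightarrow> real^'y^'u \<Rightarrow> real^'x^'x \<Rightarrow> real^'x^'u" where
  "controller_Cf Ay S Cs Df T = (Cs - Df ** Ay ** S) ** matrix_inv T"

text \<open>Time is \<open>[0, \<infinity>)\<close>; the values of processes and filtrations at negative times are irrelevant.\<close>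

definition complete_filtered_prob_space :: "'a measure \<Rightarrow> (real \<Rightarrow> 'a measure) \<Rightarrow> bool" where
  "complete_filtered_prob_space M F \<longleftrightarrow>
     prob_space M \<and> complete_measure M \<and>
     (\<forall>t\<ge>0. subalgebra M (F t)) \<and>
     (\<forall>s t. 0 \<le> s \<and> s \<le> t \<longrightarrow> sets (F s) \<subseteq> sets (F t)) \<and>
     null_sets M \<subseteq> sets (F 0)"

definition adapted_process ::
  "(real \<Rightarrow> 'a measure) \<Rightarrow> (real \<Rightarrow> 'a \<Rightarrow> 'b::topological_space) \<Rightarrow> bool" where
  "adapted_process F X \<longleftrightarrow> (\<forall>t\<ge>0. X t \<in> borel_measurable (F t))"

text \<open>
  Vectors of independent standard Brownian motions relative to the filtration. Independence of the
  components is what the rule \<open>dm dm' = I dt\<close> expresses.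
\<close>

definition brownian_motion ::
  "'a measure \<Rightarrow> (real \<Rightarrow> 'a measure) \<Rightarrow> (real \<Rightarrow> 'a \<Rightarrow> real^'m) \<Rightarrow> bool" where
  "brownian_motion M F m \<longleftrightarrow>
     adapted_process F m \<and>
     (AE \<omega> in M. m 0 \<omega> = 0) \<and>
     (AE \<omega> in M. continuous_on {0..} (\<lambda>t. m t \<omega>)) \<and>
     (\<forall>s t. 0 \<le> s \<and> s < t \<longrightarrow>
        (\<forall>i. distributed M lborel (\<lambda>\<omega>. m t \<omega> $ i - m s \<omega> $ i) (normal_density 0 (sqrt (t - s)))) \<and>
        prob_space.indep_vars M (\<lambda>_. borel) (\<lambda>i \<omega>. m t \<omega> $ i - m s \<omega> $ i) UNIV \<and>
        prob_space.indep_set M (sets (F s))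
          {(\<lambda>\<omega>. m t \<omega> - m s \<omega>) -` U \<inter> space M | U. U \<in> sets borel})"

definition time_measurable_process ::
  "'a measure \<Rightarrow> (real \<Rightarrow> 'a \<Rightarrow> 'b::topological_space) \<Rightarrow> bool" where
  "time_measurable_process M w \<longleftrightarrow>
     (\<lambda>(t, \<omega>). w t \<omega>) \<in> borel_measurable (restrict_space lborel {0..} \<Otimes>\<^sub>M M)"

text \<open>The essential supremum is over time and outcome jointly; it is \<open>\<top>\<close> for unbounded \<open>w\<close>.\<close>

definition Linf_norm :: "'a measure \<Rightarrow> (real \<Rightarrow> 'a \<Rightarrow> 'b::real_normed_vector) \<Rightarrow> ennreal" where
  "Linf_norm M w =
     esssup (restrict_space lborel {0..} \<Otimes>\<^sub>M M) (\<lambda>(t, \<omega>). ennreal (norm (w t \<omega>)))"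

text \<open>
  \<open>dX = b dt + \<Sigma> dm\<close>. As \<open>\<Sigma>\<close> is a constant matrix, the stochastic integral of \<open>\<Sigma>\<close> over \<open>[0, t]\<close>
  is \<open>\<Sigma> (m(t) - m(0))\<close>.
\<close>

definition ito_process ::
  "'a measure \<Rightarrow> (real \<Rightarrow> 'a measure) \<Rightarrow> (real \<Rightarrow> 'a \<Rightarrow> real^'m) \<Rightarrow>
   (real \<Rightarrow> 'a \<Rightarrow> real^'n) \<Rightarrow> (real \<Rightarrow> 'a \<Rightarrow> real^'n) \<Rightarrow> real^'m^'n \<Rightarrow> bool" where
  "ito_process M F m X b \<Sigma> \<longleftrightarrow>
     adapted_process F X \<and>
     (AE \<omega> in M. \<forall>t\<ge>0.
        set_integrable lborel {0..t} (\<lambda>s. b s \<omega>) \<and>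
        X t \<omega> = X 0 \<omega> + (LINT s:{0..t}|lborel. b s \<omega>) + \<Sigma> *v (m t \<omega> - m 0 \<omega>))"

text \<open>
  The formal differential \<open>dv = a dt + g \<bullet> dm\<close> of \<open>v(X)\<close> at a state \<open>\<xi>\<close>, where \<open>dX = b dt + \<Sigma> dm\<close>,
  represented as the pair \<open>(a, g)\<close>: the expansion \<open>Dv(dX) + 1/2 D\<^sup>2v(dX, dX)\<close> reduced by
  \<open>dt dt = dt dm = 0\<close> and \<open>dm\<^sub>i dm\<^sub>j = \<delta>\<^sub>i\<^sub>j dt\<close>.
\<close>

definition ito_differential ::
  "(real^'n \<Rightarrow> real) \<Rightarrow> real^'n \<Rightarrow> real^'n \<Rightarrow> real^'m^'n \<Rightarrow> real \<times> (real^'m)" where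
  "ito_differential v \<xi> b \<Sigma> =
     (frechet_derivative v (at \<xi>) b
        + 1/2 * (\<Sum>k\<in>UNIV. frechet_derivative
             (\<lambda>z. frechet_derivative v (at z) (column k \<Sigma>)) (at \<xi>) (column k \<Sigma>)),
      \<chi> k. frechet_derivative v (at \<xi>) (column k \<Sigma>))"

text \<open>
  \<open>\<E>{dv} = a dt\<close>: conditionally on the present, \<open>dm\<close> has mean zero, so only the drift remains.
\<close>

definition expected_differential ::
  "(real^'n \<Rightarrow> real) \<Rightarrow> real^'n \<Rightarrow> real^'n \<Rightarrow> real^'m^'n \<Rightarrow> real" where
  "expected_differential v \<xi> b \<Sigma> = fst (ito_differential v \<xi> b \<Sigma>)"

text \<open>
  A pair \<open>(a, K)\<close> stands for the formal signal \<open>a + K d\<delta>\<close>. Since \<open>d\<delta> dt = 0\<close>, its product with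
  \<open>dt\<close> is \<open>a dt\<close>.
\<close>

definition times_dt :: "((real^'n) \<times> (real^'d^'n)) \<Rightarrow> real^'n" where
  "times_dt y = fst y"

definition measurement ::
  "real^'x^'y \<Rightarrow> real^'d^'y \<Rightarrow> real^'x \<Rightarrow> (real^'y) \<times> (real^'d^'y)" where
  "measurement Ay E\<^sub>y x = (Ay *v x, E\<^sub>y)"

definition control ::
  "real^'x^'u \<Rightarrow> real^'y^'u \<Rightarrow> real^'x \<Rightarrow> ((real^'y) \<times> (real^'d^'y)) \<Rightarrow> (real^'u) \<times> (real^'d^'u)" where
  "control Cf Df xf y = (Cf *v xf + Df *v fst y, Df ** snd y)"

definition plant_drift ::
  "real^'x^'x \<Rightarrow> real^'u^'x \<Rightarrow> real^'w^'x \<Rightarrow> real^'x \<Rightarrow> ((real^'u) \<times> (real^'d^'u)) \<Rightarrow> real^'w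
    \<Rightarrow> real^'x" where
  "plant_drift A B D x u w = A *v x + B *v times_dt u + D *v w"

definition controller_drift ::
  "real^'x^'x \<Rightarrow> real^'y^'x \<Rightarrow> real^'x \<Rightarrow> ((real^'y) \<times> (real^'d^'y)) \<Rightarrow> real^'x" where
  "controller_drift Af Bf xf y = Af *v xf + Bf *v times_dt y"

definition closed_loop_drift ::
  "real^'x^'x \<Rightarrow> real^'u^'x \<Rightarrow> real^'w^'x \<Rightarrow> real^'x^'y \<Rightarrow> real^'d^'y \<Rightarrow>
   real^'x^'x \<Rightarrow> real^'y^'x \<Rightarrow> real^'x^'u \<Rightarrow> real^'y^'u \<Rightarrow>
   real^'x \<Rightarrow> real^'x \<Rightarrow> real^'w \<Rightarrow> real^('x + 'x)" where
  "closed_loop_drift A B D Ay E\<^sub>y Af Bf Cf Df x xf w =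
     (let y = measurement Ay E\<^sub>y x; u = control Cf Df xf y
      in vstack (plant_drift A B D x u w) (controller_drift Af Bf xf y))"

definition closed_loop_diffusion :: "real^'m^'x \<Rightarrow> real^'m^('x + 'x)" where
  "closed_loop_diffusion E\<^sub>x = vstack E\<^sub>x 0"

lemma vstack_add: "vstack a b + vstack c d = vstack (a + c) (b + d)"
  for a :: "'a::plus^'p" and b :: "'a^'q"
  by (auto simp: vstack_def vec_eq_iff split: sum.split)

lemma vstack_mult_vec: "vstack P Q *v z = vstack (P *v z) (Q *v z)"
  for P :: "'a::semiring_1^'n^'p" and Q :: "'a^'n^'q"
  by (auto simp: vstack_def vec_eq_iff matrix_vector_mult_def split: sum.split)

lemma hstack_mult_vstack: "hstack P Q *v vstack a b = P *v a + Q *v b"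
  for P :: "'a::semiring_1^'m^'p" and Q :: "'a^'n^'p"
  by (simp add: hstack_def vstack_def vec_eq_iff matrix_vector_mult_def sum.Plus
      flip: UNIV_Plus_UNIV)

text \<open>The drift is \<open>A\<^sub>c X + D\<^sub>c w\<close>; the measurement noise has dropped out.\<close>

lemma closed_loop_drift_eq:
  "closed_loop_drift A B D Ay E\<^sub>y Af Bf Cf Df x xf w =
     block2 (A + B ** Df ** Ay) (B ** Cf)
            (Bf ** Ay)          Af        *v vstack x xf
     + vstack D 0 *v w"
  by (simp add: closed_loop_drift_def Let_def measurement_def control_def plant_drift_def
      controller_drift_def times_dt_def block2_def vstack_mult_vec hstack_mult_vstack vstack_add
      matrix_vector_mult_add_rdistrib matrix_vector_right_distrib matrix_vector_mul_assoc
      matrix_mul_assoc algebra_simps)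

definition closed_loop_trajectory ::
  "'a measure \<Rightarrow> (real \<Rightarrow> 'a measure) \<Rightarrow> (real \<Rightarrow> 'a \<Rightarrow> real^'m) \<Rightarrow>
   real^'x^'x \<Rightarrow> real^'u^'x \<Rightarrow> real^'w^'x \<Rightarrow> real^'x^'y \<Rightarrow> real^'m^'x \<Rightarrow> real^'d^'y \<Rightarrow>
   real^'x^'x \<Rightarrow> real^'y^'x \<Rightarrow> real^'x^'u \<Rightarrow> real^'y^'u \<Rightarrow>
   real^'x \<Rightarrow> (real \<Rightarrow> 'a \<Rightarrow> real^'w) \<Rightarrow> (real \<Rightarrow> 'a \<Rightarrow> real^'x) \<Rightarrow> (real \<Rightarrow> 'a \<Rightarrow> real^'x) \<Rightarrow> bool"
  where
  "closed_loop_trajectory M F m A B D Ay E\<^sub>x E\<^sub>y Af Bf Cf Df x0 w x xf \<longleftrightarrow>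
     adapted_process F w \<and> time_measurable_process M w \<and>
     ito_process M F m (\<lambda>t \<omega>. vstack (x t \<omega>) (xf t \<omega>))
       (\<lambda>t \<omega>. closed_loop_drift A B D Ay E\<^sub>y Af Bf Cf Df (x t \<omega>) (xf t \<omega>) (w t \<omega>))
       (closed_loop_diffusion E\<^sub>x) \<and>
     integrable M (\<lambda>\<omega>. (norm (vstack (x 0 \<omega>) (xf 0 \<omega>)))\<^sup>2) \<and>
     integral\<^sup>L M (x 0) = x0"

end

theory Submission
  imports Defs
begin

text \<open>
  The linear matrix inequality is the Lyapunov inequality of the closed loop in suitable coordinates.
  Write \<open>x = S a + b\<close> and \<open>x\<^sub>f = T a\<close>. Then \<open>u = C\<^sub>s a + D\<^sub>f A\<^sub>y b\<close>, and the controller is chosen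
  such that the derivative of \<open>V = a\<cdot>S a + 2 a\<cdot>b + b\<cdot>W b\<close> along the closed loop loses its mixed terms
  in \<open>a\<close> and \<open>b\<close>: half of it is
  \<open>a\<cdot>(A S + B C\<^sub>s) a + b\<cdot>(W A + B\<^sub>s A\<^sub>y) b + a\<cdot>D w + b\<cdot>W D w\<close> (\<open>lyapunov_derivative\<close>). The
  derivative minus \<open>\<gamma>\<^sup>* \<bar>w\<bar>\<^sup>2\<close> is the quadratic form of the third constraint at the block vector
  \<open>(a, b, w, 0, 0)\<close>; it is negative definite, which leaves a quadratic margin
  (\<open>closed_loop_lyapunov\<close>). The second constraint makes \<open>V\<close> positive definite, and with it
  \<open>S - W\<^sup>-\<^sup>1\<close> invertible.

  For the dissipation inequality, the Ito differential of \<open>1/2 X\<cdot>P X\<close> has the drift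
  \<open>X\<cdot>P b + 1/2 tr (\<Sigma>' P \<Sigma>)\<close>. The first summand is the Lyapunov derivative. The second is a constant,
  and since the first constraint forces \<open>tr N > 0\<close>, scaling \<open>P\<close> by a small positive number brings it
  below \<open>tr N\<close>.

  The mean-square bound is proved path by path, because the noise is additive. On
  \<open>[t\<^sub>0, t\<^sub>0 + h]\<close> with \<open>1 \<le> h \<le> 2\<close>, subtract from \<open>X\<close> the perturbation
  \<open>G t = \<integral> D\<^sub>c w + \<Sigma> (m t - m t\<^sub>0)\<close>. The rest \<open>U\<close> is continuously differentiable with
  \<open>U' = A\<^sub>c (U + G)\<close>, so a Gronwall argument on each path bounds \<open>V (U (t\<^sub>0 + h))\<close> by \<open>e\<^sup>-\<^sup>\<kappa> V (X t\<^sub>0)\<close>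
  and the integral of \<open>\<bar>G\<bar>\<^sup>2\<close> (\<open>linear_path_step\<close>). Brownian increments have second moment
  \<open>CARD('m) (t - s)\<close>, and \<open>w\<close> is bounded along almost every path, hence expectations satisfy
  \<open>E V (X (t\<^sub>0 + h)) \<le> \<rho> E V (X t\<^sub>0) + k\<^sub>1 L\<^sup>2 + k\<^sub>2\<close> with \<open>\<rho> < 1\<close> (\<open>linear_ito_step\<close>). Every \<open>t \<ge> 1\<close>
  is a sum of \<open>\<lfloor>t\<rfloor>\<close> equal steps of such a length, so iteration gives the bound on the limit
  superior (\<open>contraction_steps_bound\<close>).
\<close>

section \<open>Block vectors and block matrices\<close>

lemma vstack_inner: "vstack a b \<bullet> vstack c d = a \<bullet> c + b \<bullet> d"
  for a c :: "real^'p" and b d :: "real^'q"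
  by (simp add: inner_vec_def vstack_def sum.Plus flip: UNIV_Plus_UNIV)

lemma vstack_norm: "(norm (vstack a b))\<^sup>2 = (norm a)\<^sup>2 + (norm b)\<^sup>2"
  for a :: "real^'p" and b :: "real^'q"
  by (simp add: power2_norm_eq_inner vstack_inner)

lemma vstack_eq_0_iff: "vstack a b = 0 \<longleftrightarrow> a = 0 \<and> b = 0"
  for a :: "real^'p" and b :: "real^'q"
  by (force simp: vstack_def vec_eq_iff split: sum.splits)

lemma vstack_exhaust:
  fixes z :: "'a^('p::finite + 'q::finite)"
  obtains a b where "z = vstack a b"
proof
  show "z = vstack (\<chi> i. z $ Inl i) (\<chi> i. z $ Inr i)"
    by (auto simp: vstack_def vec_eq_iff split: sum.split)
qed

lemma vstack_inject: "vstack a b = vstack c d \<longleftrightarrow> a = c \<and> b = d"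
  by (force simp: vstack_def vec_eq_iff split: sum.splits)

lemma block2_mult_vstack:
  "block2 P Q R S *v vstack a b = vstack (P *v a + Q *v b) (R *v a + S *v b)"
  for P :: "real^'m^'p" and Q :: "real^'n^'p"
  by (simp add: block2_def vstack_mult_vec hstack_mult_vstack)

lemma transpose_block2:
  "transpose (block2 P Q R S) = block2 (transpose P) (transpose R) (transpose Q) (transpose S)"
  by (auto simp: block2_def hstack_def vstack_def transpose_def vec_eq_iff split: sum.split)

lemma block2_inject:
  fixes P P' :: "real^'m^'p" and Q Q' :: "real^'n^'p" and R R' :: "real^'m^'q" and S S' :: "real^'n^'q"
  shows "block2 P Q R S = block2 P' Q' R' S' \<longleftrightarrow> P = P' \<and> Q = Q' \<and> R = R' \<and> S = S'"
proof -
  have "hstack A B = hstack C D \<longleftrightarrow> A = C \<and> B = D"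
    for A C :: "real^'m^'p" and B D :: "real^'n^'p"
    by (auto simp: hstack_def vec_eq_iff[where 'b='p] vstack_inject)
  moreover have "hstack A B = hstack C D \<longleftrightarrow> A = C \<and> B = D"
    for A C :: "real^'m^'q" and B D :: "real^'n^'q"
    by (auto simp: hstack_def vec_eq_iff[where 'b='q] vstack_inject)
  ultimately show ?thesis
    by (auto simp: block2_def vstack_inject)
qed

section \<open>Definite matrices and their quadratic forms\<close>

lemma inner_transpose_mult: "x \<bullet> (transpose A *v y) = (A *v x) \<bullet> y"
  for A :: "real^'n^'m"
  by (metis transpose_matrix_vector dot_lmul_matrix inner_commute)

lemma matrix_mult_bounded:
  fixes A :: "real^'n^'m"
  obtains K where "K > 0" "\<And>x. norm (A *v x) \<le> K * norm x"
proof -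
  obtain K where "0 < K" "\<forall>x. norm (A *v x) \<le> norm x * K"
    using bounded_linear.pos_bounded[OF matrix_vector_mul_bounded_linear[of A]] by auto
  then show ?thesis using that by (simp add: mult.commute)
qed

lemma matrix_vector_mult_uminus: "(- A) *v x = - (A *v x)" for A :: "real^'n^'m"
  by (simp add: matrix_vector_mult_def vec_eq_iff sum_negf)

text \<open>
  The form attains a positive minimum on the unit sphere, and it is homogeneous of degree two.
\<close>

lemma positive_form_coercive:
  fixes A :: "real^'n^'n"
  assumes "\<And>x. x \<noteq> 0 \<Longrightarrow> 0 < x \<bullet> (A *v x)"
  obtains e where "e > 0" "\<And>x. e * (norm x)\<^sup>2 \<le> x \<bullet> (A *v x)"
proof -
  let ?q = "\<lambda>x. x \<bullet> (A *v x)"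
  obtain i :: 'n where True by simp
  have ne: "sphere (0::real^'n) 1 \<noteq> {}"
    using norm_axis_1[of i] by (auto simp: sphere_def dist_norm intro!: exI[of _ "axis i 1"])
  have "continuous_on (sphere 0 1) ?q"
    by (intro continuous_intros)
  from continuous_attains_inf[OF compact_sphere ne this]
  obtain u where u: "u \<in> sphere 0 1" "\<And>y. y \<in> sphere 0 1 \<Longrightarrow> ?q u \<le> ?q y"
    by auto
  show ?thesis
  proof
    show "0 < ?q u" using u(1) by (intro assms) auto
    fix x :: "real^'n"
    show "?q u * (norm x)\<^sup>2 \<le> ?q x"
    proof (cases "x = 0")
      case False
      then have "?q u \<le> ?q ((1 / norm x) *\<^sub>R x)"
        by (intro u(2)) simp
      also have "\<dots> = ?q x / (norm x)\<^sup>2"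
        by (simp add: matrix_vector_mult_scaleR power2_eq_square)
      finally show ?thesis using False by (simp add: field_simps)
    qed simp
  qed
qed

lemma posdef_coercive:
  assumes "posdef A"
  obtains e where "e > 0" "\<And>x. e * (norm x)\<^sup>2 \<le> x \<bullet> (A *v x)"
  using positive_form_coercive[of A] assms unfolding posdef_def by blast

lemma negdef_coercive:
  assumes "negdef A"
  obtains e where "e > 0" "\<And>x. x \<bullet> (A *v x) \<le> - e * (norm x)\<^sup>2"
proof (rule positive_form_coercive[of "- A"])
  show "0 < x \<bullet> (- A *v x)" if "x \<noteq> 0" for x
    using assms that by (simp add: negdef_def matrix_vector_mult_uminus)
  fix e assume "0 < e" "\<And>x. e * (norm x)\<^sup>2 \<le> x \<bullet> (- A *v x)"
  then show thesis by (intro that[of e]) (simp_all add: matrix_vector_mult_uminus le_minus_iff)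
qed

lemma positive_form_invertible:
  fixes A :: "real^'n^'n"
  assumes "\<And>x. x \<noteq> 0 \<Longrightarrow> 0 < x \<bullet> (A *v x)"
  shows "invertible A"
proof -
  have "\<forall>x. A *v x = 0 \<longrightarrow> x = 0" using assms by (metis inner_zero_right less_irrefl)
  then show ?thesis
    by (metis matrix_left_invertible_ker invertible_left_inverse)
qed

lemma posdef_trace_pos:
  fixes N :: "real^'n^'n"
  assumes "posdef N"
  shows "0 < trace N"
proof -
  have "axis i 1 \<bullet> (N *v axis i 1) = N $ i $ i" for i
    by (simp add: matrix_vector_mult_basis inner_axis' column_def)
  then have "0 < N $ i $ i" for i
    using assms unfolding posdef_def by (metis axis_eq_0_iff zero_neq_one)
  then show ?thesis unfolding trace_def by (intro sum_pos) auto
qed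

lemma quadratic_form_symmetric:
  fixes P :: "real^'n^'n"
  assumes "transpose P = P"
  shows "y \<bullet> (P *v z) = z \<bullet> (P *v y)"
  using inner_transpose_mult[of y P z] assms by (simp add: inner_commute)

lemma quadratic_form_bounded:
  fixes P :: "real^'n^'n"
  obtains K where "K > 0" "\<And>z. z \<bullet> (P *v z) \<le> K * (norm z)\<^sup>2"
proof -
  obtain K where K: "K > 0" "\<And>x. norm (P *v x) \<le> K * norm x"
    using matrix_mult_bounded by blast
  have "z \<bullet> (P *v z) \<le> K * (norm z)\<^sup>2" for z
  proof -
    have "z \<bullet> (P *v z) \<le> norm z * norm (P *v z)" by (rule norm_cauchy_schwarz)
    also have "\<dots> \<le> norm z * (K * norm z)" by (intro mult_left_mono K) simp
    finally show ?thesis by (simp add: power2_eq_square mult_ac)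
  qed
  with K(1) show ?thesis by (rule that)
qed

text \<open>
  This is \<open>0 \<le> \<parallel>\<surd>\<eta> x - y / \<surd>\<eta>\<parallel>\<^sup>2\<close> in the norm of \<open>P\<close>. A small \<open>\<eta>\<close> costs the first argument little;
  later this lets a contraction survive the passage from the smooth part of a path to the path.
\<close>

lemma posdef_add_le:
  assumes P: "posdef P" and "\<eta> > 0"
  shows "(x + y) \<bullet> (P *v (x + y)) \<le> (1 + \<eta>) * (x \<bullet> (P *v x)) + (1 + 1/\<eta>) * (y \<bullet> (P *v y))"
proof -
  obtain s where s: "s > 0" "\<eta> = s\<^sup>2"
    using \<open>\<eta> > 0\<close> that[of "sqrt \<eta>"] by simp
  let ?z = "s *\<^sub>R x - (1 / s) *\<^sub>R y"
  have "0 \<le> ?z \<bullet> (P *v ?z)"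
    using P unfolding posdef_def by (cases "?z = 0") (auto intro: less_imp_le)
  also have "?z \<bullet> (P *v ?z) = \<eta> * (x \<bullet> (P *v x)) - 2 * (x \<bullet> (P *v y)) + 1 / \<eta> * (y \<bullet> (P *v y))"
    using s P quadratic_form_symmetric[of P y x]
    by (simp add: posdef_def matrix_vector_mult_diff_distrib matrix_vector_mult_scaleR
        inner_diff_left inner_diff_right field_simps power2_eq_square)
  finally show ?thesis
    using P quadratic_form_symmetric[of P y x]
    by (simp add: posdef_def matrix_vector_right_distrib inner_add_left inner_add_right algebra_simps)
qed

lemma posdef_scaleR: "0 < c \<Longrightarrow> posdef P \<Longrightarrow> posdef (c *\<^sub>R P)" for P :: "real^'n^'n"
  by (simp add: posdef_def transpose_scalar flip: scaleR_matrix_vector_assoc)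

lemma
  fixes A :: "real^'n^'n"
  assumes "invertible A"
  shows matrix_inv_right: "A ** matrix_inv A = mat 1"
    and matrix_inv_left: "matrix_inv A ** A = mat 1"
  using assms someI_ex[of "\<lambda>A'. A ** A' = mat 1 \<and> A' ** A = mat 1"]
  by (simp_all add: invertible_def matrix_inv_def)

lemma invertible_matrix_inv_mult:
  fixes A :: "real^'n^'n"
  assumes "invertible A"
  shows "A *v (matrix_inv A *v x) = x" "matrix_inv A *v (A *v x) = x"
  using assms by (simp_all add: matrix_vector_mul_assoc matrix_inv_left matrix_inv_right)

section \<open>The Lyapunov function of the closed loop\<close>

lemma transpose_plus: "transpose (A + B) = transpose A + transpose B" for A B :: "real^'n^'m"
  by (simp add: transpose_def vec_eq_iff)

text \<open>
  The coordinate change \<open>(x, x\<^sub>f) \<mapsto> (a, b)\<close> that inverts \<open>x = S a + b\<close>, \<open>x\<^sub>f = T a\<close>.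
\<close>

definition lyapunov_coords :: "real^'x^'x \<Rightarrow> real^'x^'x \<Rightarrow> real^('x + 'x)^('x + 'x)" where
  "lyapunov_coords S T = block2 0 (matrix_inv T) (mat 1) (- (S ** matrix_inv T))"

lemma lyapunov_coords_mult:
  "lyapunov_coords S T *v vstack x xf = vstack (matrix_inv T *v xf) (x - S *v (matrix_inv T *v xf))"
  by (simp add: lyapunov_coords_def block2_mult_vstack matrix_vector_mul_assoc matrix_vector_mult_uminus)

text \<open>
  A symmetric block matrix has symmetric diagonal blocks, so the transpose on \<open>W\<close> disappears. The
  definiteness of \<open>N\<close> and \<open>W\<close> is read off from block vectors with one zero block, and \<open>S - W\<^sup>-\<^sup>1\<close> is
  the Schur complement: its form at \<open>a\<close> is the value of the block form at \<open>(a, - W\<^sup>-\<^sup>1 a)\<close>.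
\<close>

lemma sdp_feasible_posdef:
  assumes "sdp_feasible A B D Ay E\<^sub>x \<Gamma>0 \<Gamma>1 g S W Bs Cs Df N"
  shows "posdef N" "posdef (block2 S (mat 1) (mat 1) W)" "posdef W"
    "invertible (S - matrix_inv W)"
proof -
  have N: "posdef (block2 N (transpose E\<^sub>x) E\<^sub>x W)"
    and Q': "posdef (block2 S (mat 1) (mat 1) (transpose W))"
    using assms by (auto simp: sdp_feasible_def)
  have tN: "transpose N = N" and tW: "transpose W = W"
    using N by (auto simp: posdef_def transpose_block2 block2_inject)
  show Q: "posdef (block2 S (mat 1) (mat 1) W)"
    using Q' tW by simp
  show "posdef N"
    unfolding posdef_def
  proof (intro conjI allI impI tN)
    fix a :: "real^'e" assume "a \<noteq> 0"
    then have "vstack a (0::real^'a) \<noteq> 0" by (simp add: vstack_eq_0_iff)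
    then have "0 < vstack a 0 \<bullet> (block2 N (transpose E\<^sub>x) E\<^sub>x W *v vstack a 0)"
      using N unfolding posdef_def by blast
    then show "0 < a \<bullet> (N *v a)"
      by (simp add: block2_mult_vstack vstack_inner)
  qed
  show W: "posdef W"
    unfolding posdef_def
  proof (intro conjI allI impI tW)
    fix b :: "real^'a" assume "b \<noteq> 0"
    then have "vstack (0::real^'a) b \<noteq> 0" by (simp add: vstack_eq_0_iff)
    then have "0 < vstack 0 b \<bullet> (block2 S (mat 1) (mat 1) W *v vstack 0 b)"
      using Q unfolding posdef_def by blast
    then show "0 < b \<bullet> (W *v b)"
      by (simp add: block2_mult_vstack vstack_inner)
  qed
  then have iW: "invertible W"
    by (auto simp: posdef_def intro: positive_form_invertible)
  show "invertible (S - matrix_inv W)"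
  proof (rule positive_form_invertible)
    fix a :: "real^'a" assume "a \<noteq> 0"
    \<comment> \<open>This choice of the second block minimises the block form for given \<open>a\<close>.\<close>
    let ?b = "- (matrix_inv W *v a)"
    have "vstack a ?b \<noteq> 0" using \<open>a \<noteq> 0\<close> by (simp add: vstack_eq_0_iff)
    then have "0 < vstack a ?b \<bullet> (block2 S (mat 1) (mat 1) W *v vstack a ?b)"
      using Q unfolding posdef_def by blast
    then show "0 < a \<bullet> ((S - matrix_inv W) *v a)"
      by (simp add: block2_mult_vstack vstack_inner inner_diff_right inner_add_right vec.neg
          invertible_matrix_inv_mult[OF iW] matrix_vector_mult_diff_rdistrib)
  qed
qed

text \<open>
  The quadratic form of the third constraint at \<open>(a, b, w, 0, 0)\<close>. The zero blocks belong to the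
  weights \<open>\<Gamma>0\<close> and \<open>\<Gamma>1\<close>, and coercivity supplies the margin \<open>e\<close>.
\<close>

lemma sdp_feasible_dissipation:
  fixes A S W :: "real^'x^'x" and B :: "real^'u^'x" and D :: "real^'w^'x" and Ay :: "real^'x^'y"
  assumes "sdp_feasible A B D Ay E\<^sub>x \<Gamma>0 \<Gamma>1 g S W Bs Cs Df N"
  obtains e where "e > 0"
    "\<And>a b w. 2 * (a \<bullet> ((A ** S + B ** Cs) *v a) + b \<bullet> ((W ** A + Bs ** Ay) *v b)
        + a \<bullet> (D *v w) + b \<bullet> (W *v (D *v w)))
      \<le> g * (norm w)\<^sup>2 - e * ((norm a)\<^sup>2 + (norm b)\<^sup>2)"
proof -
  let ?L = "block3
       (Psi1 A B S Cs)   0                      (transpose (Psi4 A B D S Cs))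
       0                 (Phi3 A Ay W Bs)       (transpose (Phi5 A B D Ay W Df))
       (Psi4 A B D S Cs) (Phi5 A B D Ay W Df)   (Psi6 D g \<Gamma>0 \<Gamma>1)"
  have "negdef ?L" using assms by (simp add: sdp_feasible_def)
  then obtain e where e: "e > 0" "\<And>x. x \<bullet> (?L *v x) \<le> - e * (norm x)\<^sup>2"
    using negdef_coercive by blast
  show ?thesis
  proof
    show "e > 0" by fact
    fix a b :: "real^'x" and w :: "real^'w"
    let ?c = "vstack w (vstack 0 0) :: real^('w + ('x + 'x))"
    let ?x = "vstack a (vstack b ?c)"
    have q: "u \<bullet> (transpose K *v u) = u \<bullet> (K *v u)" for u :: "real^'x" and K
      by (simp add: inner_transpose_mult inner_commute del: transpose_matrix_vector)
    have "Phi3 A Ay W Bs = W ** A + Bs ** Ay + transpose (W ** A + Bs ** Ay)"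
      by (simp add: Phi3_def matrix_transpose_mul transpose_plus)
    then have F: "b \<bullet> (Phi3 A Ay W Bs *v b) = 2 * (b \<bullet> ((W ** A + Bs ** Ay) *v b))"
      by (simp only: matrix_vector_mult_add_rdistrib[of _ "transpose _"] inner_add_right q)
    have P: "a \<bullet> (Psi1 A B S Cs *v a) = 2 * (a \<bullet> ((A ** S + B ** Cs) *v a))"
      by (simp only: Psi1_def matrix_vector_mult_add_rdistrib[of _ "transpose _"] inner_add_right q)
    have P4: "?c \<bullet> (Psi4 A B D S Cs *v a) = a \<bullet> (D *v w)"
      by (simp add: Psi4_def inner_transpose_mult hstack_mult_vstack inner_commute
          del: transpose_matrix_vector)
    have P4': "transpose (Psi4 A B D S Cs) *v ?c = D *v w"
      by (simp add: Psi4_def hstack_mult_vstack)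
    have P5: "?c \<bullet> (Phi5 A B D Ay W Df *v b) = b \<bullet> (W *v (D *v w))"
      by (simp add: Phi5_def inner_transpose_mult hstack_mult_vstack inner_commute matrix_vector_mul_assoc
          del: transpose_matrix_vector)
    have P5': "transpose (Phi5 A B D Ay W Df) *v ?c = W *v (D *v w)"
      by (simp add: Phi5_def hstack_mult_vstack matrix_vector_mul_assoc)
    have P6: "?c \<bullet> (Psi6 D g \<Gamma>0 \<Gamma>1 *v ?c) = - g * (norm w)\<^sup>2"
      by (simp add: Psi6_def block3_def vstack_mult_vec hstack_mult_vstack vstack_inner
          matrix_vector_mult_uminus power2_norm_eq_inner flip: scaleR_matrix_vector_assoc)
    have "?x \<bullet> (?L *v ?x) = 2 * (a \<bullet> ((A ** S + B ** Cs) *v a) + b \<bullet> ((W ** A + Bs ** Ay) *v b)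
        + a \<bullet> (D *v w) + b \<bullet> (W *v (D *v w))) - g * (norm w)\<^sup>2"
      unfolding block3_def vstack_mult_vec hstack_mult_vstack[where ?b="vstack b ?c"]
        hstack_mult_vstack[where ?b="?c"] vstack_inner[of a] vstack_inner[of b]
        P4' P5' inner_add_right P F P4 P5 P6
      by simp
    moreover have "?x \<bullet> (?L *v ?x) \<le> - e * ((norm a)\<^sup>2 + (norm b)\<^sup>2)"
    proof (rule order_trans[OF e(2)])
      show "- e * (norm ?x)\<^sup>2 \<le> - e * ((norm a)\<^sup>2 + (norm b)\<^sup>2)"
        using e(1) by (simp add: vstack_norm)
    qed
    ultimately show "2 * (a \<bullet> ((A ** S + B ** Cs) *v a) + b \<bullet> ((W ** A + Bs ** Ay) *v b)
        + a \<bullet> (D *v w) + b \<bullet> (W *v (D *v w)))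
      \<le> g * (norm w)\<^sup>2 - e * ((norm a)\<^sup>2 + (norm b)\<^sup>2)"
      by simp
  qed
qed

text \<open>
  In the new coordinates the controller reads \<open>(S - W\<^sup>-\<^sup>1) a' = r\<close>, where
  \<open>r = (A S + B C\<^sub>s) a + W\<^sup>-\<^sup>1 (A + B D\<^sub>f A\<^sub>y)' a + (B D\<^sub>f - W\<^sup>-\<^sup>1 B\<^sub>s) A\<^sub>y b\<close>, and the plant reads
  \<open>x' = p = (A S + B C\<^sub>s) a + (A + B D\<^sub>f A\<^sub>y) b + D w\<close> with \<open>b' = p - S a'\<close>. Half the derivative of
  \<open>V\<close> is then \<open>a\<cdot>p + b\<cdot>W p - b\<cdot>W r\<close>, and the three parts of \<open>r\<close> are exactly what cancels the
  mixed terms and replaces \<open>B D\<^sub>f A\<^sub>y\<close> by \<open>B\<^sub>s A\<^sub>y\<close>.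
\<close>

lemma lyapunov_derivative:
  fixes A S W T :: "real^'x^'x" and B :: "real^'u^'x" and D :: "real^'w^'x" and Ay :: "real^'x^'y"
    and E\<^sub>y :: "real^'d^'y" and Bs :: "real^'y^'x" and Cs :: "real^'x^'u" and Df :: "real^'y^'u"
    and x xf :: "real^'x"
  assumes W: "posdef W" and X: "invertible (S - matrix_inv W)" and T: "posdef T"
  defines "Af \<equiv> controller_Af A B Ay S W Bs Cs Df T"
    and "Bf \<equiv> controller_Bf B S W Bs Df T"
    and "Cf \<equiv> controller_Cf Ay S Cs Df T"
  defines "a \<equiv> matrix_inv T *v xf" and "b \<equiv> x - S *v (matrix_inv T *v xf)"
  shows "vstack a b \<bullet> (block2 S (mat 1) (mat 1) W *v
       (lyapunov_coords S T *v closed_loop_drift A B D Ay E\<^sub>y Af Bf Cf Df x xf w))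
     = a \<bullet> ((A ** S + B ** Cs) *v a) + b \<bullet> ((W ** A + Bs ** Ay) *v b)
        + a \<bullet> (D *v w) + b \<bullet> (W *v (D *v w))"
proof -
  define Wi Xi where "Wi = matrix_inv W" and "Xi = matrix_inv (S - Wi)"
  have iW: "invertible W" and iT: "invertible T"
    using W T by (auto simp: posdef_def intro: positive_form_invertible)
  have WWi: "W *v (Wi *v z) = z" for z
    using iW by (simp add: Wi_def invertible_matrix_inv_mult)
  have XXi: "W *v (S *v (Xi *v z)) - Xi *v z = W *v z" for z
  proof -
    have "W *v ((S - Wi) *v (Xi *v z)) = W *v z"
      using X by (simp add: Wi_def Xi_def invertible_matrix_inv_mult)
    then show ?thesis
      by (simp add: matrix_vector_mult_diff_rdistrib matrix_vector_mult_diff_distrib WWi)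
  qed
  have tWi: "transpose Wi *v z = Wi *v z" for z
  proof -
    have "W *v (transpose Wi *v z) = transpose (Wi ** W) *v z"
      using W by (simp add: posdef_def matrix_transpose_mul matrix_vector_mul_assoc
          del: transpose_matrix_vector)
    also have "\<dots> = z" using iW by (simp add: Wi_def matrix_inv_left)
    finally show ?thesis by (metis WWi iW Wi_def invertible_matrix_inv_mult(2))
  qed
  have xf: "xf = T *v a" and x: "x = S *v a + b"
    using iT by (simp_all add: a_def b_def invertible_matrix_inv_mult)
  define p where "p = (A ** S + B ** Cs) *v a + (A + B ** Df ** Ay) *v b + D *v w"
  define r where "r = (A ** S + B ** Cs) *v a + Wi *v (transpose (A + B ** Df ** Ay) *v a)
      + (B ** Df - Wi ** Bs) *v (Ay *v b)"
  have Tia: "matrix_inv T *v (T *v z) = z" for z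
    using iT by (simp add: invertible_matrix_inv_mult)
  note mv = matrix_vector_mult_add_rdistrib matrix_vector_mult_diff_rdistrib
    matrix_vector_mult_diff_distrib matrix_vector_right_distrib
    matrix_vector_mul_assoc[symmetric]
  have "closed_loop_drift A B D Ay E\<^sub>y Af Bf Cf Df x xf w = vstack p (T *v (Xi *v r))"
    unfolding closed_loop_drift_def Let_def measurement_def control_def plant_drift_def
      controller_drift_def times_dt_def Af_def Bf_def Cf_def controller_Af_def controller_Bf_def
      controller_Cf_def vstack_inject p_def r_def xf x Wi_def[symmetric] Xi_def[symmetric]
    by (simp add: mv Tia tWi algebra_simps del: transpose_matrix_vector)
  then have "lyapunov_coords S T *v closed_loop_drift A B D Ay E\<^sub>y Af Bf Cf Df x xf w
      = vstack (Xi *v r) (p - S *v (Xi *v r))"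
    by (simp add: lyapunov_coords_mult Tia)
  then have "vstack a b \<bullet> (block2 S (mat 1) (mat 1) W *v
       (lyapunov_coords S T *v closed_loop_drift A B D Ay E\<^sub>y Af Bf Cf Df x xf w))
      = a \<bullet> p + b \<bullet> (W *v p) - b \<bullet> (W *v (S *v (Xi *v r)) - Xi *v r)"
    by (simp add: block2_mult_vstack vstack_inner mv inner_add_right inner_diff_right)
  also have "\<dots> = a \<bullet> p + b \<bullet> (W *v p) - b \<bullet> (W *v r)"
    by (simp only: XXi)
  also have "\<dots> = a \<bullet> ((A ** S + B ** Cs) *v a) + b \<bullet> ((W ** A + Bs ** Ay) *v b)
        + a \<bullet> (D *v w) + b \<bullet> (W *v (D *v w))"
  proof -
    have 1: "a \<bullet> ((A + B ** Df ** Ay) *v b) = b \<bullet> (transpose (A + B ** Df ** Ay) *v a)"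
      by (simp only: inner_transpose_mult inner_commute)
    have 2: "a \<bullet> p = a \<bullet> ((A ** S + B ** Cs) *v a) + b \<bullet> (transpose (A + B ** Df ** Ay) *v a)
        + a \<bullet> (D *v w)"
      by (simp only: p_def inner_add_right 1)
    have 3: "b \<bullet> (W *v r) = b \<bullet> (W *v ((A ** S + B ** Cs) *v a))
        + b \<bullet> (transpose (A + B ** Df ** Ay) *v a)
        + b \<bullet> (W *v ((B ** Df - Wi ** Bs) *v (Ay *v b)))"
      by (simp only: r_def inner_add_right matrix_vector_right_distrib WWi)
    have 4: "W *v ((B ** Df - Wi ** Bs) *v (Ay *v b)) = W *v ((B ** Df ** Ay) *v b) - Bs *v (Ay *v b)"
      by (simp add: mv WWi)
    show ?thesis
      unfolding 2 3 4 by (simp add: p_def mv inner_add_right inner_diff_right)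
  qed
  finally show ?thesis .
qed

text \<open>
  The matrix \<open>P\<close> is the pullback of the block matrix of \<open>V\<close> along the coordinate change. As the
  coordinate change is injective, \<open>P\<close> is definite and the margin in \<open>(a, b)\<close> turns into a margin in
  \<open>(x, x\<^sub>f)\<close>.
\<close>

lemma closed_loop_lyapunov:
  fixes A S W T :: "real^'x^'x" and B :: "real^'u^'x" and D :: "real^'w^'x" and Ay :: "real^'x^'y"
  assumes feas: "sdp_feasible A B D Ay E\<^sub>x \<Gamma>0 \<Gamma>1 g S W Bs Cs Df N" and T: "posdef T"
  obtains P \<alpha> \<beta> where "posdef (P :: real^('x + 'x)^('x + 'x))" "\<alpha> > 0" "\<beta> > 0"
    "\<And>(E\<^sub>y :: real^'d^'y) x xf (w :: real^'w). vstack x xf \<bullet> (P *v closed_loop_drift A B D Ay E\<^sub>y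
        (controller_Af A B Ay S W Bs Cs Df T) (controller_Bf B S W Bs Df T)
        (controller_Cf Ay S Cs Df T) Df x xf w)
      \<le> - \<alpha> * (norm (vstack x xf))\<^sup>2 + \<beta> * (norm w)\<^sup>2"
proof -
  let ?J = "lyapunov_coords S T" and ?Q = "block2 S (mat 1) (mat 1) W"
  define P where "P = transpose ?J ** ?Q ** ?J"
  have Q: "posdef ?Q" and W: "posdef W" and X: "invertible (S - matrix_inv W)"
    using sdp_feasible_posdef[OF feas] by auto
  have iT: "invertible T"
    using T by (auto simp: posdef_def intro: positive_form_invertible)
  have J0: "?J *v z \<noteq> 0" if "z \<noteq> 0" for z
  proof
    assume 0: "?J *v z = 0"
    obtain x xf where z: "z = vstack x xf" by (rule vstack_exhaust)
    have "matrix_inv T *v xf = 0" "x = 0"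
      using 0 by (auto simp: z lyapunov_coords_mult vstack_eq_0_iff)
    then have "z = 0"
      using invertible_matrix_inv_mult(1)[OF iT, of xf] by (simp add: z vstack_eq_0_iff)
    with that show False by simp
  qed
  have form: "z \<bullet> (P *v y) = (?J *v z) \<bullet> (?Q *v (?J *v y))" for z y
    by (simp add: P_def inner_transpose_mult del: transpose_matrix_vector flip: matrix_vector_mul_assoc)
  have P: "posdef P"
    unfolding posdef_def
  proof (intro conjI allI impI)
    show "transpose P = P"
      using Q by (simp add: P_def posdef_def matrix_transpose_mul matrix_mul_assoc)
    show "0 < z \<bullet> (P *v z)" if "z \<noteq> 0" for z
      using Q J0[OF that] unfolding form posdef_def by blast
  qed
  have "0 < z \<bullet> ((transpose ?J ** ?J) *v z)" if "z \<noteq> 0" for z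
    using J0[OF that] by (simp add: inner_transpose_mult del: transpose_matrix_vector flip: matrix_vector_mul_assoc)
  then obtain k where k: "k > 0" "\<And>z. k * (norm z)\<^sup>2 \<le> z \<bullet> ((transpose ?J ** ?J) *v z)"
    using positive_form_coercive by blast
  have k': "k * (norm z)\<^sup>2 \<le> (norm (?J *v z))\<^sup>2" for z
    using k(2)[of z] by (simp add: inner_transpose_mult power2_norm_eq_inner del: transpose_matrix_vector flip: matrix_vector_mul_assoc)
  obtain e where e: "e > 0"
    "\<And>a b w. 2 * (a \<bullet> ((A ** S + B ** Cs) *v a) + b \<bullet> ((W ** A + Bs ** Ay) *v b)
        + a \<bullet> (D *v w) + b \<bullet> (W *v (D *v w)))
      \<le> g * (norm w)\<^sup>2 - e * ((norm a)\<^sup>2 + (norm b)\<^sup>2)"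
    using sdp_feasible_dissipation[OF feas] by blast
  show ?thesis
  proof
    show "posdef P" by fact
    show "e * k / 2 > 0" using e k by simp
    show "(\<bar>g\<bar> + 1) / 2 > 0" by simp
    fix E\<^sub>y :: "real^'d^'y" and x xf and w :: "real^'w"
    let ?a = "matrix_inv T *v xf" and ?b = "x - S *v (matrix_inv T *v xf)"
    have J: "?J *v vstack x xf = vstack ?a ?b" by (rule lyapunov_coords_mult)
    have "e * (k * (norm (vstack x xf))\<^sup>2) \<le> e * ((norm ?a)\<^sup>2 + (norm ?b)\<^sup>2)"
      using k'[of "vstack x xf"] e(1) unfolding J vstack_norm[of ?a] by simp
    moreover have "g * (norm w)\<^sup>2 \<le> (\<bar>g\<bar> + 1) * (norm w)\<^sup>2"
      by (intro mult_right_mono) auto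
    ultimately show "vstack x xf \<bullet> (P *v closed_loop_drift A B D Ay E\<^sub>y
        (controller_Af A B Ay S W Bs Cs Df T) (controller_Bf B S W Bs Df T)
        (controller_Cf Ay S Cs Df T) Df x xf w)
      \<le> - (e * k / 2) * (norm (vstack x xf))\<^sup>2 + (\<bar>g\<bar> + 1) / 2 * (norm w)\<^sup>2"
      unfolding form J lyapunov_derivative[OF W X T]
      using e(2)[of ?a ?b w] by (simp add: mult.assoc)
  qed
qed

section \<open>The Ito differential of a quadratic form\<close>

lemma expected_differential_quadratic:
  fixes P :: "real^'n^'n" and \<Sigma> :: "real^'m^'n"
  assumes "transpose P = P"
  shows "expected_differential (\<lambda>X. 1/2 * (X \<bullet> (P *v X))) \<xi> b \<Sigma>
    = \<xi> \<bullet> (P *v b) + 1/2 * (\<Sum>k\<in>UNIV. column k \<Sigma> \<bullet> (P *v column k \<Sigma>))"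
proof -
  note sym = quadratic_form_symmetric[OF assms]
  have L: "((\<lambda>z. P *v z) has_derivative (\<lambda>h. P *v h)) (at z)" for z :: "real^'n"
    by (rule bounded_linear_imp_has_derivative[OF matrix_vector_mul_bounded_linear])
  have "((\<lambda>X. 1/2 * (X \<bullet> (P *v X))) has_derivative (\<lambda>h. z \<bullet> (P *v h))) (at z)" for z
    by (rule has_derivative_eq_rhs[OF has_derivative_mult_right[OF
          has_derivative_inner[OF has_derivative_ident L]]])
      (simp add: fun_eq_iff sym[of _ z])
  then have 1: "frechet_derivative (\<lambda>X. 1/2 * (X \<bullet> (P *v X))) (at z) = (\<lambda>h. z \<bullet> (P *v h))" for z
    by (rule frechet_derivative_at[symmetric])
  have "((\<lambda>z. z \<bullet> (P *v c)) has_derivative (\<lambda>h. h \<bullet> (P *v c))) (at z)" for z c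
    by (intro has_derivative_inner_left has_derivative_ident)
  then have 2: "frechet_derivative (\<lambda>z. z \<bullet> (P *v c)) (at z) = (\<lambda>h. h \<bullet> (P *v c))" for z c
    by (rule frechet_derivative_at[symmetric])
  show ?thesis
    unfolding expected_differential_def ito_differential_def 1 2 by simp
qed

section \<open>Decay along the paths of a perturbed linear system\<close>

lemma continuous_on_matrix_vector_mult:
  "continuous_on S f \<Longrightarrow> continuous_on S (\<lambda>x. A *v f x)" for A :: "real^'n^'m"
  by (rule bounded_linear.continuous_on[OF matrix_vector_mul_bounded_linear])

text \<open>
  The cross term \<open>2 u\<cdot>P A g\<close> is split by Young's inequality so that it uses up half of the decay
  \<open>2 \<alpha> \<bar>u\<bar>\<^sup>2\<close>.
\<close>

lemma lyapunov_perturbed: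
  fixes A P :: "real^'n^'n"
  assumes P: "posdef P" and "\<alpha> > 0" and dec: "\<And>z. z \<bullet> (P *v (A *v z)) \<le> - \<alpha> * (norm z)\<^sup>2"
  obtains \<kappa> C where "\<kappa> > 0" "C \<ge> 0"
    "\<And>u g. 2 * (u \<bullet> (P *v (A *v (u + g)))) \<le> - \<kappa> * (u \<bullet> (P *v u)) + C * (norm g)\<^sup>2"
proof -
  obtain p where p: "p > 0" "\<And>z. z \<bullet> (P *v z) \<le> p * (norm z)\<^sup>2"
    using quadratic_form_bounded by blast
  obtain K where K: "K > 0" "\<And>x. norm ((P ** A) *v x) \<le> K * norm x"
    using matrix_mult_bounded by blast
  show ?thesis
  proof
    show "\<alpha> / p > 0" "K\<^sup>2 / \<alpha> \<ge> 0" using \<open>\<alpha> > 0\<close> p by auto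
    fix u g
    have 1: "\<alpha> / p * (u \<bullet> (P *v u)) \<le> \<alpha> * (norm u)\<^sup>2"
      using mult_left_mono[OF p(2)[of u], of "\<alpha> / p"] p(1) \<open>\<alpha> > 0\<close> by simp
    have "u \<bullet> ((P ** A) *v g) \<le> norm u * norm ((P ** A) *v g)" by (rule norm_cauchy_schwarz)
    also have "\<dots> \<le> norm u * (K * norm g)" by (intro mult_left_mono K) simp
    finally have 2: "u \<bullet> (P *v (A *v g)) \<le> norm u * (K * norm g)"
      by (simp add: matrix_vector_mul_assoc)
    have "0 \<le> (\<alpha> * norm u - K * norm g)\<^sup>2 / \<alpha>" using \<open>\<alpha> > 0\<close> by simp
    also have "\<dots> = \<alpha> * (norm u)\<^sup>2 - 2 * (norm u * (K * norm g)) + K\<^sup>2 / \<alpha> * (norm g)\<^sup>2"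
      using \<open>\<alpha> > 0\<close> by (simp add: field_simps power2_eq_square)
    finally have 3: "2 * (norm u * (K * norm g)) \<le> \<alpha> * (norm u)\<^sup>2 + K\<^sup>2 / \<alpha> * (norm g)\<^sup>2" by simp
    show "2 * (u \<bullet> (P *v (A *v (u + g)))) \<le> - (\<alpha> / p) * (u \<bullet> (P *v u)) + K\<^sup>2 / \<alpha> * (norm g)\<^sup>2"
      using 1 2 3 dec[of u] by (simp add: matrix_vector_right_distrib inner_add_right)
  qed
qed

text \<open>
  Gronwall's inequality for \<open>U = X - G\<close>. The perturbation \<open>G\<close> is only continuous, and the lemma applies
  to Brownian paths because only \<open>U\<close>, whose derivative is \<open>A X\<close>, is differentiated.
\<close>

lemma perturbed_lyapunov_decay:
  fixes A P :: "real^'n^'n" and X G :: "real \<Rightarrow> real^'n"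
  assumes "a \<le> b" and P: "transpose P = P" and "C \<ge> 0" and "\<kappa> \<ge> 0"
    and key: "\<And>u g. 2 * (u \<bullet> (P *v (A *v (u + g)))) \<le> - \<kappa> * (u \<bullet> (P *v u)) + C * (norm g)\<^sup>2"
    and X: "continuous_on {a..b} X" and G: "continuous_on {a..b} G"
    and eq: "\<And>t. t \<in> {a..b} \<Longrightarrow> X t = X a + integral {a..t} (\<lambda>s. A *v X s) + G t"
  defines "V \<equiv> \<lambda>z. z \<bullet> (P *v z)"
  shows "V (X b - G b) \<le> exp (- \<kappa> * (b - a)) * V (X a) + C * integral {a..b} (\<lambda>s. (norm (G s))\<^sup>2)"
proof -
  define U where "U = (\<lambda>t. X a + integral {a..t} (\<lambda>s. A *v X s))"
  define I where "I = (\<lambda>t. integral {a..t} (\<lambda>s. (norm (G s))\<^sup>2))"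
  have XU: "X t = U t + G t" if "t \<in> {a..b}" for t
    using eq[OF that] by (simp add: U_def)
  have cAX: "continuous_on {a..b} (\<lambda>s. A *v X s)"
    by (rule continuous_on_matrix_vector_mult[OF X])
  have dU: "(U has_vector_derivative A *v X t) (at t within {a..b})" if "t \<in> {a..b}" for t
    unfolding U_def using integral_has_vector_derivative[OF cAX that]
    by (auto intro!: derivative_eq_intros)
  have dI: "(I has_vector_derivative (norm (G t))\<^sup>2) (at t within {a..b})" if "t \<in> {a..b}" for t
    unfolding I_def by (rule integral_has_vector_derivative[OF _ that]) (intro continuous_intros G)
  have dV: "((\<lambda>t. V (U t)) has_vector_derivative 2 * (U t \<bullet> (P *v (A *v X t)))) (at t within {a..b})"
    if "t \<in> {a..b}" for t
  proof -
    have D: "(U has_derivative (\<lambda>h. h *\<^sub>R (A *v X t))) (at t within {a..b})"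
      using dU[OF that] by (simp add: has_vector_derivative_def)
    have "((\<lambda>t. P *v U t) has_derivative (\<lambda>h. P *v (h *\<^sub>R (A *v X t)))) (at t within {a..b})"
      by (rule bounded_linear.has_derivative[OF matrix_vector_mul_bounded_linear D])
    from has_derivative_inner[OF D this] show ?thesis
      unfolding has_vector_derivative_def V_def
      by (rule has_derivative_eq_rhs)
         (simp add: fun_eq_iff matrix_vector_mult_scaleR quadratic_form_symmetric[OF P, of _ "U t"]
           algebra_simps)
  qed
  \<comment> \<open>The weight of \<open>I\<close> is the largest value of the exponential on \<open>{a..b}\<close>; this makes \<open>psi\<close>
     nonincreasing.\<close>
  define psi where "psi = (\<lambda>t. exp (\<kappa> * (t - a)) * V (U t) - C * exp (\<kappa> * (b - a)) * I t)"
  have dpsi: "(psi has_vector_derivative exp (\<kappa> * (t - a)) * (\<kappa> * V (U t) + 2 * (U t \<bullet> (P *v (A *v X t))))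
      - C * exp (\<kappa> * (b - a)) * (norm (G t))\<^sup>2) (at t within {a..b})"
    if "t \<in> {a..b}" for t
    using dV[OF that] dI[OF that] unfolding psi_def has_real_derivative_iff_has_vector_derivative[symmetric]
    by (auto intro!: derivative_eq_intros simp: algebra_simps)
  have "psi b \<le> psi a"
  proof (rule DERIV_nonpos_imp_decreasing_open[OF \<open>a \<le> b\<close>])
    show "continuous_on {a..b} psi"
      by (rule continuous_on_vector_derivative[OF dpsi])
    fix t assume t: "a < t" "t < b"
    have "at t within {a..b} = at t" using t by (simp add: at_within_Icc_at)
    then have "DERIV psi t :> exp (\<kappa> * (t - a)) * (\<kappa> * V (U t) + 2 * (U t \<bullet> (P *v (A *v X t))))
      - C * exp (\<kappa> * (b - a)) * (norm (G t))\<^sup>2"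
      using dpsi[of t] t by (simp add: has_real_derivative_iff_has_vector_derivative)
    moreover have "exp (\<kappa> * (t - a)) * (\<kappa> * V (U t) + 2 * (U t \<bullet> (P *v (A *v X t))))
        \<le> exp (\<kappa> * (t - a)) * (C * (norm (G t))\<^sup>2)"
      using key[of "U t" "G t"] XU[of t] t by (intro mult_left_mono) (auto simp: V_def)
    moreover have "exp (\<kappa> * (t - a)) * (C * (norm (G t))\<^sup>2) \<le> exp (\<kappa> * (b - a)) * (C * (norm (G t))\<^sup>2)"
      using t \<open>\<kappa> \<ge> 0\<close> \<open>C \<ge> 0\<close> by (intro mult_right_mono) (auto intro: mult_left_mono)
    ultimately show "\<exists>y. DERIV psi t :> y \<and> y \<le> 0"
      by (intro exI conjI) (auto simp: algebra_simps)
  qed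
  then have "exp (\<kappa> * (b - a)) * V (U b) \<le> V (X a) + C * exp (\<kappa> * (b - a)) * I b"
    by (simp add: psi_def U_def I_def)
  moreover have "v \<le> 1 / E * y + C * z" if "E * v \<le> y + C * E * z" "E > 0" for E v y z :: real
    using that by (simp add: field_simps)
  ultimately have "V (U b) \<le> 1 / exp (\<kappa> * (b - a)) * V (X a) + C * I b"
    by simp
  then have "V (U b) \<le> exp (- \<kappa> * (b - a)) * V (X a) + C * I b"
    by (simp add: exp_minus divide_inverse)
  moreover have "U b = X b - G b" using XU[of b] \<open>a \<le> b\<close> by simp
  ultimately show ?thesis by (simp add: I_def)
qed

lemma norm_integral_le_ae:
  fixes f :: "real \<Rightarrow> 'b::euclidean_space"
  assumes "f integrable_on {a..b}" "a \<le> b" "negligible {s \<in> {a..b}. \<not> norm (f s) \<le> K}" "K \<ge> 0"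
  shows "norm (integral {a..b} f) \<le> K * (b - a)"
proof -
  let ?g = "\<lambda>s. if norm (f s) \<le> K then f s else 0"
  have eq: "?g s = f s" if "s \<in> {a..b} - {s \<in> {a..b}. \<not> norm (f s) \<le> K}" for s
    using that by auto
  have "integral {a..b} ?g = integral {a..b} f"
    by (rule integral_spike[OF assms(3)]) (use eq in auto)
  moreover have "?g integrable_on {a..b}"
    by (rule integrable_spike[OF assms(1,3)]) (rule eq)
  then have g: "(?g has_integral integral {a..b} ?g) {a..b}" by (rule integrable_integral)
  have "norm (integral {a..b} ?g) \<le> K * measure lborel {a..b}"
    by (rule has_integral_bound_real[OF \<open>K \<ge> 0\<close> finite.emptyI g]) (use \<open>K \<ge> 0\<close> in auto)
  ultimately show ?thesis using \<open>a \<le> b\<close> by simp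
qed

text \<open>
  The perturbation collects the disturbance, which contributes at most \<open>2 d L\<close> on an interval of
  length at most 2, and the noise. The state at the end is \<open>U + G\<close>, and passing from \<open>V U\<close> to \<open>V (U + G)\<close>
  costs the factor \<open>1 + \<eta>\<close>.
\<close>

lemma linear_path_step:
  fixes A P :: "real^'n^'n" and D :: "real^'w^'n" and \<Sigma> :: "real^'m^'n"
    and X :: "real \<Rightarrow> real^'n" and w :: "real \<Rightarrow> real^'w" and m :: "real \<Rightarrow> real^'m"
  assumes P: "posdef P" and "C \<ge> 0" and "\<kappa> \<ge> 0" and "\<eta> > 0" and "L \<ge> 0" and "d \<ge> 0" and "\<sigma> \<ge> 0"
    and key: "\<And>u g. 2 * (u \<bullet> (P *v (A *v (u + g)))) \<le> - \<kappa> * (u \<bullet> (P *v u)) + C * (norm g)\<^sup>2"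
    and p: "\<And>z. z \<bullet> (P *v z) \<le> p * (norm z)\<^sup>2" "p \<ge> 0"
    and d: "\<And>z. norm (D *v z) \<le> d * norm z" and \<sigma>: "\<And>z. norm (\<Sigma> *v z) \<le> \<sigma> * norm z"
    and t0: "0 \<le> t0" and h: "1 \<le> h" "h \<le> 2"
    and m: "continuous_on {0..} m"
    and int: "\<And>t. 0 \<le> t \<Longrightarrow> (\<lambda>s. A *v X s + D *v w s) integrable_on {0..t}"
    and X: "\<And>t. 0 \<le> t \<Longrightarrow> X t = X 0 + integral {0..t} (\<lambda>s. A *v X s + D *v w s) + \<Sigma> *v (m t - m 0)"
    and w: "negligible {s. 0 \<le> s \<and> \<not> norm (w s) \<le> L}"
  defines "V \<equiv> \<lambda>z. z \<bullet> (P *v z)"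
  defines "q \<equiv> (1 + \<eta>) * C" and "r \<equiv> (1 + 1/\<eta>) * p"
  shows "V (X (t0 + h)) \<le> (1 + \<eta>) * exp (- \<kappa>) * V (X t0) + (2 * q + r) * (8 * d\<^sup>2 * L\<^sup>2)
      + 2 * \<sigma>\<^sup>2 * q * integral {t0..t0 + h} (\<lambda>s. (norm (m s - m t0))\<^sup>2)
      + 2 * \<sigma>\<^sup>2 * r * (norm (m (t0 + h) - m t0))\<^sup>2"
proof -
  define t1 where "t1 = t0 + h"
  have t01: "t0 \<le> t1" "0 \<le> t1" using h t0 by (auto simp: t1_def)
  have contm: "continuous_on {0..t1} m" by (rule continuous_on_subset[OF m]) auto
  have cX: "continuous_on {0..t1} X"
  proof -
    have "continuous_on {0..t1} (\<lambda>t. X 0 + integral {0..t} (\<lambda>s. A *v X s + D *v w s) + \<Sigma> *v (m t - m 0))"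
      by (intro continuous_on_add continuous_on_const indefinite_integral_continuous_1[OF int[OF t01(2)]]
          continuous_on_matrix_vector_mult[OF continuous_on_diff[OF contm continuous_on_const]])
    then show ?thesis by (rule continuous_on_eq) (rule X[symmetric], simp)
  qed
  have cX': "continuous_on {t0..t1} X" by (rule continuous_on_subset[OF cX]) (use t0 in auto)
  have iA: "(\<lambda>s. A *v X s) integrable_on {t0..t}" if "t \<in> {t0..t1}" for t
    by (intro integrable_continuous_interval continuous_on_matrix_vector_mult
        continuous_on_subset[OF cX']) (use that in auto)
  have iB: "(\<lambda>s. A *v X s + D *v w s) integrable_on {t0..t}" if "t \<in> {t0..t1}" for t
    by (rule integrable_subinterval_real[OF int[of t]]) (use that t0 in auto)
  have iD: "(\<lambda>s. D *v w s) integrable_on {t0..t}" if "t \<in> {t0..t1}" for t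
    using integrable_diff[OF iB[OF that] iA[OF that]] by simp
  define G where "G = (\<lambda>t. integral {t0..t} (\<lambda>s. D *v w s) + \<Sigma> *v (m t - m t0))"
  have cG: "continuous_on {t0..t1} G"
    unfolding G_def
    by (intro continuous_on_add indefinite_integral_continuous_1 iD
        continuous_on_matrix_vector_mult[OF continuous_on_diff[OF continuous_on_subset[OF contm] continuous_on_const]])
      (use t01 t0 in auto)
  have eq: "X t = X t0 + integral {t0..t} (\<lambda>s. A *v X s) + G t" if t: "t \<in> {t0..t1}" for t
  proof -
    let ?b = "\<lambda>s. A *v X s + D *v w s"
    have "integral {0..t0} ?b + integral {t0..t} ?b = integral {0..t} ?b"
      by (rule Henstock_Kurzweil_Integration.integral_combine) (use t t0 int[of t] in auto)
    moreover have "integral {t0..t} ?b = integral {t0..t} (\<lambda>s. A *v X s) + integral {t0..t} (\<lambda>s. D *v w s)"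
      by (rule integral_add[OF iA[OF t] iD[OF t]])
    moreover have "\<Sigma> *v (m t - m 0) = \<Sigma> *v (m t - m t0) + \<Sigma> *v (m t0 - m 0)"
      by (simp flip: matrix_vector_right_distrib)
    moreover have "x1 = x0 + k1 + (k2 + n)"
      if "x1 = x + j1 + n1" "x0 = x + j0 + n0" "j0 + k = j1" "k = k1 + k2" "n1 = n + n0"
      for x x0 x1 j0 j1 k k1 k2 n n0 n1 :: "real^'n"
      using that by simp
    ultimately show ?thesis
      unfolding G_def using X[of t] X[of t0] t t0 by simp
  qed
  have Gb: "(norm (G t))\<^sup>2 \<le> 8 * d\<^sup>2 * L\<^sup>2 + 2 * \<sigma>\<^sup>2 * (norm (m t - m t0))\<^sup>2" if t: "t \<in> {t0..t1}" for t
  proof -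
    have "negligible {s \<in> {t0..t}. \<not> norm (D *v w s) \<le> d * L}"
    proof (rule negligible_subset[OF w])
      show "{s \<in> {t0..t}. \<not> norm (D *v w s) \<le> d * L} \<subseteq> {s. 0 \<le> s \<and> \<not> norm (w s) \<le> L}"
        using t0 by (auto intro: order_trans[OF d] mult_left_mono[OF _ \<open>d \<ge> 0\<close>])
    qed
    then have "norm (integral {t0..t} (\<lambda>s. D *v w s)) \<le> d * L * (t - t0)"
      by (intro norm_integral_le_ae iD t) (use t \<open>d \<ge> 0\<close> \<open>L \<ge> 0\<close> in auto)
    also have "\<dots> \<le> d * L * 2"
      using t h \<open>d \<ge> 0\<close> \<open>L \<ge> 0\<close> by (intro mult_left_mono) (auto simp: t1_def)
    finally have "norm (G t) \<le> 2 * d * L + \<sigma> * norm (m t - m t0)"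
      unfolding G_def using \<sigma>[of "m t - m t0"] by (intro norm_triangle_le) simp
    then have "(norm (G t))\<^sup>2 \<le> (2 * d * L + \<sigma> * norm (m t - m t0))\<^sup>2"
      by (intro power_mono) auto
    also have "\<dots> \<le> 2 * (2 * d * L)\<^sup>2 + 2 * (\<sigma> * norm (m t - m t0))\<^sup>2"
      using zero_le_power2[of "2 * d * L - \<sigma> * norm (m t - m t0)"]
      by (simp add: power2_sum power2_diff)
    finally show ?thesis by (simp add: power_mult_distrib)
  qed
  have cm: "continuous_on {t0..t1} (\<lambda>s. (norm (m s - m t0))\<^sup>2)"
    by (intro continuous_intros continuous_on_subset[OF contm]) (use t0 in auto)
  have IG: "integral {t0..t1} (\<lambda>s. (norm (G s))\<^sup>2)
      \<le> 2 * (8 * d\<^sup>2 * L\<^sup>2) + 2 * \<sigma>\<^sup>2 * integral {t0..t1} (\<lambda>s. (norm (m s - m t0))\<^sup>2)"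
  proof -
    have "integral {t0..t1} (\<lambda>s. (norm (G s))\<^sup>2)
      \<le> integral {t0..t1} (\<lambda>s. 8 * d\<^sup>2 * L\<^sup>2 + 2 * \<sigma>\<^sup>2 * (norm (m s - m t0))\<^sup>2)"
      by (intro integral_le integrable_continuous_interval continuous_intros cG cm Gb)
    also have "\<dots> = 8 * d\<^sup>2 * L\<^sup>2 * h + 2 * \<sigma>\<^sup>2 * integral {t0..t1} (\<lambda>s. (norm (m s - m t0))\<^sup>2)"
      using h by (subst integral_add[OF integrable_const_ivl
            integrable_on_mult_right[OF integrable_continuous_interval[OF cm]]]) (simp add: t1_def)
    also have "8 * d\<^sup>2 * L\<^sup>2 * h \<le> 8 * d\<^sup>2 * L\<^sup>2 * 2" using h by (intro mult_left_mono) auto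
    finally show ?thesis by simp
  qed
  have Vnn: "0 \<le> V z" for z
    using P unfolding V_def posdef_def by (cases "z = 0") (auto intro: less_imp_le)
  have "V (X t1 - G t1) \<le> exp (- \<kappa> * (t1 - t0)) * V (X t0) + C * integral {t0..t1} (\<lambda>s. (norm (G s))\<^sup>2)"
    unfolding V_def
    by (rule perturbed_lyapunov_decay[OF t01(1) _ \<open>C \<ge> 0\<close> \<open>\<kappa> \<ge> 0\<close> key cX' cG eq])
      (use P in \<open>auto simp: posdef_def\<close>)
  also have "\<dots> \<le> exp (- \<kappa>) * V (X t0) + C * (2 * (8 * d\<^sup>2 * L\<^sup>2) + 2 * \<sigma>\<^sup>2 * integral {t0..t1} (\<lambda>s. (norm (m s - m t0))\<^sup>2))"
    using h \<open>\<kappa> \<ge> 0\<close> mult_left_mono[of 1 h \<kappa>]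
    by (intro add_mono mult_right_mono mult_left_mono IG Vnn \<open>C \<ge> 0\<close>) (auto simp: t1_def)
  finally have 1: "V (X t1 - G t1) \<le> \<dots>" .
  have 2: "V (G t1) \<le> p * (8 * d\<^sup>2 * L\<^sup>2 + 2 * \<sigma>\<^sup>2 * (norm (m t1 - m t0))\<^sup>2)"
    unfolding V_def using p(1)[of "G t1"] mult_left_mono[OF Gb[of t1] p(2)] t01 by auto
  have "V (X t1) \<le> (1 + \<eta>) * V (X t1 - G t1) + (1 + 1/\<eta>) * V (G t1)"
    using posdef_add_le[OF P \<open>\<eta> > 0\<close>, of "X t1 - G t1" "G t1"] by (simp add: V_def)
  also have "\<dots> \<le> (1 + \<eta>) * (exp (- \<kappa>) * V (X t0) + C * (2 * (8 * d\<^sup>2 * L\<^sup>2)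
        + 2 * \<sigma>\<^sup>2 * integral {t0..t1} (\<lambda>s. (norm (m s - m t0))\<^sup>2)))
      + (1 + 1/\<eta>) * (p * (8 * d\<^sup>2 * L\<^sup>2 + 2 * \<sigma>\<^sup>2 * (norm (m t1 - m t0))\<^sup>2))"
    using \<open>\<eta> > 0\<close> by (intro add_mono mult_left_mono 1 2) auto
  finally have "V (X t1) \<le> \<dots>" .
  moreover have "c1 * (e * v + C * (2 * x + s * I)) + c2 * (p * (x + s * n))
      = c1 * e * v + (2 * (c1 * C) + c2 * p) * x + s * (c1 * C) * I + s * (c2 * p) * n"
    for c1 c2 e v x s I n :: real
    by (simp add: algebra_simps)
  ultimately show ?thesis
    unfolding q_def r_def t1_def by (simp only:)
qed

section \<open>Second moments of Brownian increments and bounds along paths\<close>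

lemma adapted_process_measurable:
  assumes "complete_filtered_prob_space M F" "adapted_process F X" "0 \<le> t"
  shows "X t \<in> borel_measurable M"
  using assms unfolding complete_filtered_prob_space_def adapted_process_def
  by (metis measurable_from_subalg)

lemma nn_integral_normal_square:
  assumes "\<sigma> > 0"
  shows "(\<integral>\<^sup>+x. ennreal (normal_density 0 \<sigma> x) * ennreal (x\<^sup>2) \<partial>lborel) = ennreal (\<sigma>\<^sup>2)"
proof -
  have "has_bochner_integral lborel (\<lambda>x. normal_density 0 \<sigma> x * x\<^sup>2) (\<sigma>\<^sup>2)"
    using normal_moment_even[of \<sigma> 0 1] assms by (simp add: power_divide)
  then have "(\<integral>\<^sup>+x. ennreal (normal_density 0 \<sigma> x * x\<^sup>2) \<partial>lborel) = ennreal (\<sigma>\<^sup>2)"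
    by (simp add: has_bochner_integral_iff nn_integral_eq_integral)
  then show ?thesis by (simp add: ennreal_mult')
qed

lemma brownian_increment_second_moment:
  fixes m :: "real \<Rightarrow> 'a \<Rightarrow> real^'m" and s t :: real
  assumes F: "complete_filtered_prob_space M F" and m: "brownian_motion M F m" and st: "0 \<le> s" "s \<le> t"
  shows "(\<integral>\<^sup>+\<omega>. ennreal ((norm (m t \<omega> - m s \<omega>))\<^sup>2) \<partial>M) = ennreal (CARD('m) * (t - s))"
proof (cases "s = t")
  case False
  with st have "s < t" by simp
  have meas: "m u \<in> borel_measurable M" if "0 \<le> u" for u
    using adapted_process_measurable[OF F _ that] m by (auto simp: brownian_motion_def)
  have [measurable]: "m s \<in> borel_measurable M" "m t \<in> borel_measurable M"
    using meas st by auto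
  have D: "distributed M lborel (\<lambda>\<omega>. m t \<omega> $ i - m s \<omega> $ i) (normal_density 0 (sqrt (t - s)))" for i
    using m \<open>s < t\<close> st(1) unfolding brownian_motion_def by blast
  have i: "(\<integral>\<^sup>+\<omega>. ennreal ((m t \<omega> $ i - m s \<omega> $ i)\<^sup>2) \<partial>M) = ennreal (t - s)" for i
  proof -
    have "(\<integral>\<^sup>+\<omega>. ennreal ((m t \<omega> $ i - m s \<omega> $ i)\<^sup>2) \<partial>M)
        = (\<integral>\<^sup>+x. ennreal (normal_density 0 (sqrt (t - s)) x) * ennreal (x\<^sup>2) \<partial>lborel)"
      by (rule distributed_nn_integral[OF D, symmetric]) measurable
    then show ?thesis
      using \<open>s < t\<close> by (simp add: nn_integral_normal_square)
  qed
  have cm: "(\<lambda>\<omega>. ennreal ((m t \<omega> $ i - m s \<omega> $ i)\<^sup>2)) \<in> borel_measurable M" for i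
  proof -
    have "(\<lambda>\<omega>. ennreal (((m t \<omega> - m s \<omega>) \<bullet> axis i 1)\<^sup>2)) \<in> borel_measurable M" by measurable
    then show ?thesis by (simp add: inner_axis)
  qed
  have "(norm (m t \<omega> - m s \<omega>))\<^sup>2 = (\<Sum>i\<in>UNIV. (m t \<omega> $ i - m s \<omega> $ i)\<^sup>2)" for \<omega>
    by (simp add: power2_norm_eq_inner inner_vec_def) (simp add: power2_eq_square)
  then have "(\<integral>\<^sup>+\<omega>. ennreal ((norm (m t \<omega> - m s \<omega>))\<^sup>2) \<partial>M)
      = (\<integral>\<^sup>+\<omega>. (\<Sum>i\<in>UNIV. ennreal ((m t \<omega> $ i - m s \<omega> $ i)\<^sup>2)) \<partial>M)"
    by (simp add: sum_ennreal)
  also have "\<dots> = (\<Sum>i\<in>(UNIV :: 'm set). ennreal (t - s))"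
    by (simp add: nn_integral_sum[OF cm] i del: sum_ennreal)
  finally show ?thesis
    using st by (simp add: ennreal_mult ennreal_of_nat_eq_real_of_nat)
qed simp

text \<open>
  The process is the pointwise limit of its values at the times \<open>\<lfloor>n s\<rfloor> / n\<close>, which are countably
  many for each \<open>n\<close>.
\<close>

lemma continuous_process_jointly_measurable:
  fixes y :: "real \<Rightarrow> 'a \<Rightarrow> real"
  assumes y: "\<And>s. y s \<in> borel_measurable M"
    and cont: "\<And>\<omega>. \<omega> \<in> space M \<Longrightarrow> continuous_on UNIV (\<lambda>s. y s \<omega>)"
  shows "(\<lambda>(s, \<omega>). y s \<omega>) \<in> borel_measurable (lborel \<Otimes>\<^sub>M M)"
proof (rule borel_measurable_LIMSEQ_real)
  let ?u = "\<lambda>n z. y (real_of_int \<lfloor>real (Suc n) * fst z\<rfloor> / real (Suc n)) (snd z)"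
  show "?u n \<in> borel_measurable (lborel \<Otimes>\<^sub>M M)" for n
  proof (rule measurable_compose_countable[of "\<lambda>k z. y (real_of_int k / real (Suc n)) (snd z)"])
    show "(\<lambda>z. y (real_of_int k / real (Suc n)) (snd z)) \<in> borel_measurable (lborel \<Otimes>\<^sub>M M)" for k
      by (rule measurable_compose[OF measurable_snd y])
    show "(\<lambda>z. \<lfloor>real (Suc n) * fst z\<rfloor>) \<in> lborel \<Otimes>\<^sub>M M \<rightarrow>\<^sub>M count_space UNIV"
      by measurable
  qed
  fix z :: "real \<times> 'a" assume "z \<in> space (lborel \<Otimes>\<^sub>M M)"
  then have \<omega>: "snd z \<in> space M" by (auto simp: space_pair_measure)
  have "(\<lambda>n. real_of_int \<lfloor>real (Suc n) * fst z\<rfloor> / real (Suc n)) \<longlonglongrightarrow> fst z"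
  proof (rule real_tendsto_sandwich)
    have "real (Suc n) * fst z - 1 \<le> real_of_int \<lfloor>real (Suc n) * fst z\<rfloor>" for n by linarith
    then have "(real (Suc n) * fst z - 1) / real (Suc n) \<le> real_of_int \<lfloor>real (Suc n) * fst z\<rfloor> / real (Suc n)" for n
      by (intro divide_right_mono) auto
    moreover have "(real (Suc n) * fst z - 1) / real (Suc n) = fst z - inverse (real (Suc n))" for n
      by (simp add: diff_divide_distrib inverse_eq_divide del: of_nat_Suc)
    ultimately show "\<forall>\<^sub>F n in sequentially. fst z - inverse (real (Suc n)) \<le> real_of_int \<lfloor>real (Suc n) * fst z\<rfloor> / real (Suc n)"
      by simp
    have "real_of_int \<lfloor>real (Suc n) * fst z\<rfloor> / real (Suc n) \<le> real (Suc n) * fst z / real (Suc n)" for n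
      by (intro divide_right_mono) auto
    then show "\<forall>\<^sub>F n in sequentially. real_of_int \<lfloor>real (Suc n) * fst z\<rfloor> / real (Suc n) \<le> fst z"
      by (simp del: of_nat_Suc)
    show "(\<lambda>n. fst z - inverse (real (Suc n))) \<longlonglongrightarrow> fst z"
      using tendsto_diff[OF tendsto_const LIMSEQ_inverse_real_of_nat] by simp
  qed simp
  then have "(\<lambda>n. y (real_of_int \<lfloor>real (Suc n) * fst z\<rfloor> / real (Suc n)) (snd z)) \<longlonglongrightarrow> y (fst z) (snd z)"
    by (rule continuous_on_tendsto_compose[OF cont[OF \<omega>]]) auto
  then show "(\<lambda>n. ?u n z) \<longlonglongrightarrow> (\<lambda>(s, \<omega>). y s \<omega>) z"
    by (simp add: case_prod_beta)
qed

text \<open>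
  The process is set to zero on a measurable null set that contains the outcomes with a discontinuous
  path. The modified process is jointly measurable, \<open>g\<close> is its time integral, and Fubini's theorem
  reduces the expectation of \<open>g\<close> to the second moments of the increments.
\<close>

lemma brownian_time_integral:
  fixes m :: "real \<Rightarrow> 'a \<Rightarrow> real^'m" and a b :: real
  assumes F: "complete_filtered_prob_space M F" and m: "brownian_motion M F m" and t: "0 \<le> a" "a \<le> b"
  obtains g where "g \<in> borel_measurable M"
    "AE \<omega> in M. ennreal (integral {a..b} (\<lambda>s. (norm (m s \<omega> - m a \<omega>))\<^sup>2)) = g \<omega>"
    "(\<integral>\<^sup>+\<omega>. g \<omega> \<partial>M) \<le> ennreal (CARD('m) * (b - a)\<^sup>2)"
proof -
  have M: "prob_space M" using F by (simp add: complete_filtered_prob_space_def)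
  interpret prob_space M by fact
  interpret pair_sigma_finite lborel M ..
  have "AE \<omega> in M. continuous_on {0..} (\<lambda>t. m t \<omega>)"
    using m by (simp add: brownian_motion_def)
  then obtain N where N: "{\<omega> \<in> space M. \<not> continuous_on {0..} (\<lambda>t. m t \<omega>)} \<subseteq> N"
      "emeasure M N = 0" "N \<in> sets M"
    by (rule AE_E)
  \<comment> \<open>Clamping the time to \<open>{a..b}\<close> makes the paths continuous on the whole real line.\<close>
  define k where "k s = max a (min s b)" for s
  have k: "0 \<le> k s" "a \<le> k s" "k s \<le> b" "s \<in> {a..b} \<Longrightarrow> k s = s" for s
    using t by (auto simp: k_def)
  define y where "y s \<omega> = (if \<omega> \<in> N then 0 else (norm (m (k s) \<omega> - m a \<omega>))\<^sup>2)" for s \<omega>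
  have meas: "m u \<in> borel_measurable M" if "0 \<le> u" for u
    using adapted_process_measurable[OF F _ that] m by (auto simp: brownian_motion_def)
  have mk[measurable]: "m (k s) \<in> borel_measurable M" for s
    by (rule meas) (rule k(1))
  have y: "y s \<in> borel_measurable M" for s
    unfolding y_def using N(3) meas[OF t(1)] by measurable
  have "continuous_on UNIV (\<lambda>s. y s \<omega>)" if "\<omega> \<in> space M" for \<omega>
  proof (cases "\<omega> \<in> N")
    case False
    with N that have c: "continuous_on {0..} (\<lambda>t. m t \<omega>)" by auto
    have "continuous_on UNIV (\<lambda>s. m (k s) \<omega>)"
      by (rule continuous_on_compose2[OF c]) (auto simp: k(1), auto simp: k_def intro!: continuous_intros)
    then have "continuous_on UNIV (\<lambda>s. (norm (m (k s) \<omega> - m a \<omega>))\<^sup>2)"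
      by (intro continuous_on_power continuous_on_norm continuous_on_diff continuous_on_const)
    then show ?thesis using False by (simp add: y_def)
  qed (simp add: y_def)
  then have joint[measurable]: "(\<lambda>(s, \<omega>). y s \<omega>) \<in> borel_measurable (lborel \<Otimes>\<^sub>M M)"
    by (intro continuous_process_jointly_measurable y)
  define f where "f = (\<lambda>(s, \<omega>). ennreal (y s \<omega>) * indicator {a..b} s)"
  have f: "f \<in> borel_measurable (lborel \<Otimes>\<^sub>M M)"
    unfolding f_def case_prod_beta using joint[unfolded case_prod_beta] by measurable
  show ?thesis
  proof
    show "(\<lambda>\<omega>. \<integral>\<^sup>+s. f (s, \<omega>) \<partial>lborel) \<in> borel_measurable M"
      using f by measurable
    have "AE \<omega> in M. \<omega> \<notin> N" using N(2,3) by (intro AE_not_in) auto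
    then show "AE \<omega> in M. ennreal (integral {a..b} (\<lambda>s. (norm (m s \<omega> - m a \<omega>))\<^sup>2)) = (\<integral>\<^sup>+s. f (s, \<omega>) \<partial>lborel)"
      using AE_space
    proof eventually_elim
      case (elim \<omega>)
      then have c: "continuous_on {0..} (\<lambda>t. m t \<omega>)" using N by auto
      have "continuous_on {a..b} (\<lambda>s. (norm (m s \<omega> - m a \<omega>))\<^sup>2)"
        by (intro continuous_on_power continuous_on_norm continuous_on_diff continuous_on_const
            continuous_on_subset[OF c]) (use t in auto)
      then have "((\<lambda>s. (norm (m s \<omega> - m a \<omega>))\<^sup>2) has_integral integral {a..b} (\<lambda>s. (norm (m s \<omega> - m a \<omega>))\<^sup>2)) {a..b}"
        by (intro integrable_integral integrable_continuous_interval)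
      then have "integral\<^sup>N lborel (\<lambda>s. ennreal ((norm (m s \<omega> - m a \<omega>))\<^sup>2) * indicator {a..b} s)
          = ennreal (integral {a..b} (\<lambda>s. (norm (m s \<omega> - m a \<omega>))\<^sup>2))"
        by (rule nn_integral_has_integral_lebesgue'[rotated]) simp
      moreover have "f (s, \<omega>) = ennreal ((norm (m s \<omega> - m a \<omega>))\<^sup>2) * indicator {a..b} s" for s
        using elim k(4)[of s] by (auto simp: f_def y_def indicator_def)
      ultimately show ?case by simp
    qed
    have "(\<integral>\<^sup>+\<omega>. \<integral>\<^sup>+s. f (s, \<omega>) \<partial>lborel \<partial>M) = (\<integral>\<^sup>+s. \<integral>\<^sup>+\<omega>. f (s, \<omega>) \<partial>M \<partial>lborel)"
      by (rule Fubini[OF f])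
    also have "\<dots> \<le> (\<integral>\<^sup>+s. ennreal (CARD('m) * (b - a)) * indicator {a..b} s \<partial>lborel)"
    proof (rule nn_integral_mono)
      fix s
      have "(\<integral>\<^sup>+\<omega>. ennreal (y s \<omega>) \<partial>M) \<le> (\<integral>\<^sup>+\<omega>. ennreal ((norm (m (k s) \<omega> - m a \<omega>))\<^sup>2) \<partial>M)"
        by (intro nn_integral_mono) (auto simp: y_def)
      also have "\<dots> = ennreal (CARD('m) * (k s - a))"
        by (rule brownian_increment_second_moment[OF F m t(1) k(2)])
      also have "\<dots> \<le> ennreal (CARD('m) * (b - a))"
        using k(3)[of s] by (intro ennreal_leI mult_left_mono) auto
      finally show "(\<integral>\<^sup>+\<omega>. f (s, \<omega>) \<partial>M) \<le> ennreal (CARD('m) * (b - a)) * indicator {a..b} s"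
        by (auto simp: f_def indicator_def)
    qed
    also have "\<dots> = ennreal (CARD('m) * (b - a)\<^sup>2)"
      using t by (simp add: nn_integral_cmult_indicator power2_eq_square mult.assoc flip: ennreal_mult)
    finally show "(\<integral>\<^sup>+\<omega>. \<integral>\<^sup>+s. f (s, \<omega>) \<partial>lborel \<partial>M) \<le> ennreal (CARD('m) * (b - a)\<^sup>2)" .
  qed
qed

text \<open>
  The essential supremum is taken over time and outcome jointly; Fubini's theorem turns the joint null
  set into null sets of times for almost every outcome.
\<close>

lemma Linf_norm_path_bound:
  fixes w :: "real \<Rightarrow> 'a \<Rightarrow> real^'w"
  assumes M: "prob_space M" and w: "time_measurable_process M w" and L: "Linf_norm M w \<le> ennreal L" "0 \<le> L"
  shows "AE \<omega> in M. negligible {s. 0 \<le> s \<and> \<not> norm (w s \<omega>) \<le> L}"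
proof -
  interpret prob_space M by fact
  let ?R = "restrict_space lborel {0::real..}"
  interpret R: sigma_finite_measure ?R
    by (rule sigma_finite_measure_restrict_space[OF sigma_finite_lborel]) auto
  interpret pair_sigma_finite ?R M ..
  have wm: "(\<lambda>z. w (fst z) (snd z)) \<in> borel_measurable (?R \<Otimes>\<^sub>M M)"
    using w by (simp add: time_measurable_process_def case_prod_beta)
  have "AE z in ?R \<Otimes>\<^sub>M M. (case z of (t, \<omega>) \<Rightarrow> ennreal (norm (w t \<omega>))) \<le> Linf_norm M w"
    unfolding Linf_norm_def by (rule esssup_AE)
  then have "AE z in ?R \<Otimes>\<^sub>M M. norm (w (fst z) (snd z)) \<le> L"
    by eventually_elim (use L in \<open>auto simp: case_prod_beta dest: order_trans\<close>)
  then have "AE t in ?R. AE \<omega> in M. norm (w t \<omega>) \<le> L"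
    by (drule_tac AE_pair) simp
  moreover have "{z \<in> space (?R \<Otimes>\<^sub>M M). norm (w (fst z) (snd z)) \<le> L} \<in> sets (?R \<Otimes>\<^sub>M M)"
    using wm by measurable
  ultimately have "AE \<omega> in M. AE t in ?R. norm (w t \<omega>) \<le> L"
    using AE_commute[of "\<lambda>t \<omega>. norm (w t \<omega>) \<le> L"] by blast
  then show ?thesis
  proof eventually_elim
    case (elim \<omega>)
    then have "AE t in lborel. t \<in> {0..} \<longrightarrow> norm (w t \<omega>) \<le> L"
      by (subst (asm) AE_restrict_space_iff) auto
    then obtain N where N: "{t \<in> space lborel. \<not> (t \<in> {0..} \<longrightarrow> norm (w t \<omega>) \<le> L)} \<subseteq> N"
        "emeasure lborel N = 0" "N \<in> sets lborel"
      by (rule AE_E)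
    then have "N \<in> null_sets lborel" by auto
    then have "negligible N"
      by (simp add: negligible_iff_null_sets null_sets_completionI)
    then show ?case by (rule negligible_subset) (use N(1) in auto)
  qed
qed

section \<open>Mean-square ultimate boundedness\<close>

text \<open>
  A time \<open>t \<ge> 1\<close> is reached in \<open>\<lfloor>t\<rfloor>\<close> steps of length \<open>t / \<lfloor>t\<rfloor>\<close>, which lies between 1 and 2. Letting
  the step length depend on \<open>t\<close> makes every time reachable from 0 in whole steps.
\<close>

lemma contraction_steps_bound:
  fixes f :: "real \<Rightarrow> ennreal"
  assumes f0: "f 0 < \<top>" and \<rho>: "0 \<le> \<rho>" "\<rho> < 1" and "0 \<le> K"
    and step: "\<And>t h. 0 \<le> t \<Longrightarrow> 1 \<le> h \<Longrightarrow> h \<le> 2 \<Longrightarrow> f (t + h) \<le> ennreal \<rho> * f t + ennreal K"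
  obtains g where "(g \<longlongrightarrow> K / (1 - \<rho>)) at_top" "\<And>t. 1 \<le> t \<Longrightarrow> f t \<le> ennreal (g t)"
proof
  define a where "a = enn2real (f 0)"
  have a: "f 0 = ennreal a" "0 \<le> a" using f0 by (simp_all add: a_def)
  let ?g = "\<lambda>t::real. \<rho> ^ nat \<lfloor>t\<rfloor> * a + K / (1 - \<rho>)"
  have "filterlim (\<lambda>t::real. nat \<lfloor>t\<rfloor>) sequentially at_top"
    by (rule filterlim_compose[OF filterlim_nat_sequentially filterlim_floor_sequentially])
  then have "((\<lambda>t::real. \<rho> ^ nat \<lfloor>t\<rfloor>) \<longlongrightarrow> 0) at_top"
    using \<rho> by (intro filterlim_compose[OF LIMSEQ_realpow_zero[OF \<rho>]])
  then show "(?g \<longlongrightarrow> K / (1 - \<rho>)) at_top"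
    by (auto intro!: tendsto_eq_intros)
  fix t :: real assume t: "1 \<le> t"
  define n where "n = nat \<lfloor>t\<rfloor>"
  have n: "1 \<le> real n" "real n \<le> t" "t \<le> 2 * real n"
  proof -
    have "1 \<le> \<lfloor>t\<rfloor>" using t by simp
    then show "1 \<le> real n" "real n \<le> t" "t \<le> 2 * real n"
      unfolding n_def by linarith+
  qed
  define h where "h = t / real n"
  have h: "1 \<le> h" "h \<le> 2" using n by (auto simp: h_def field_simps)
  have "f (real k * h) \<le> ennreal (\<rho> ^ k * a + K / (1 - \<rho>))" for k
  proof (induction k)
    case 0
    then show ?case using a \<rho> \<open>0 \<le> K\<close> by (auto intro!: ennreal_leI)
  next
    case (Suc k)
    have "f (real (Suc k) * h) = f (real k * h + h)" by (simp add: algebra_simps)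
    also have "\<dots> \<le> ennreal \<rho> * f (real k * h) + ennreal K" using h by (intro step) auto
    also have "\<dots> \<le> ennreal \<rho> * ennreal (\<rho> ^ k * a + K / (1 - \<rho>)) + ennreal K"
      by (intro add_mono mult_left_mono Suc) auto
    also have "\<dots> = ennreal (\<rho> * (\<rho> ^ k * a + K / (1 - \<rho>)) + K)"
      using \<rho> a \<open>0 \<le> K\<close> by (simp add: ennreal_mult ennreal_plus)
    also have "\<rho> * (\<rho> ^ k * a + K / (1 - \<rho>)) + K = \<rho> ^ Suc k * a + K / (1 - \<rho>)"
      using \<rho> by (simp add: field_simps)
    finally show ?case .
  qed
  from this[of n] show "f t \<le> ennreal (?g t)"
    using n by (simp add: h_def n_def)
qed

text \<open>
  The expectation of the estimate along paths. The lower bound on \<open>h\<close> gives a uniform contraction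
  factor, and the upper bound keeps the contributions of disturbance and noise bounded.
\<close>

lemma linear_ito_step:
  fixes A P :: "real^'n^'n" and D :: "real^'w^'n" and \<Sigma> :: "real^'m^'n"
    and m :: "real \<Rightarrow> 'a \<Rightarrow> real^'m"
  assumes F: "complete_filtered_prob_space M F" and m: "brownian_motion M F m"
    and P: "posdef P" and \<alpha>: "\<alpha> > 0" and dec: "\<And>z. z \<bullet> (P *v (A *v z)) \<le> - \<alpha> * (norm z)\<^sup>2"
  obtains \<rho> k1 k2 where "0 \<le> \<rho>" "\<rho> < 1" "0 \<le> k1" "0 \<le> k2"
    "\<And>X w L t h. ito_process M F m X (\<lambda>t \<omega>. A *v X t \<omega> + D *v w t \<omega>) \<Sigma> \<Longrightarrow>
       time_measurable_process M w \<Longrightarrow> Linf_norm M w \<le> ennreal L \<Longrightarrow> 0 \<le> L \<Longrightarrow>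
       0 \<le> t \<Longrightarrow> 1 \<le> h \<Longrightarrow> h \<le> 2 \<Longrightarrow>
       (\<integral>\<^sup>+\<omega>. ennreal (X (t + h) \<omega> \<bullet> (P *v X (t + h) \<omega>)) \<partial>M)
         \<le> ennreal \<rho> * (\<integral>\<^sup>+\<omega>. ennreal (X t \<omega> \<bullet> (P *v X t \<omega>)) \<partial>M) + ennreal (k1 * L\<^sup>2 + k2)"
proof -
  have M: "prob_space M" using F by (simp add: complete_filtered_prob_space_def)
  interpret prob_space M by fact
  obtain \<kappa> C where \<kappa>: "\<kappa> > 0" and C: "C \<ge> 0"
    and key: "\<And>u g. 2 * (u \<bullet> (P *v (A *v (u + g)))) \<le> - \<kappa> * (u \<bullet> (P *v u)) + C * (norm g)\<^sup>2"
    using lyapunov_perturbed[OF P \<alpha> dec] by blast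
  obtain p where p: "p > 0" "\<And>z. z \<bullet> (P *v z) \<le> p * (norm z)\<^sup>2"
    using quadratic_form_bounded[of P] by blast
  obtain d where d: "d > 0" "\<And>z. norm (D *v z) \<le> d * norm z"
    using matrix_mult_bounded[of D] by blast
  obtain \<sigma> where \<sigma>: "\<sigma> > 0" "\<And>z. norm (\<Sigma> *v z) \<le> \<sigma> * norm z"
    using matrix_mult_bounded[of \<Sigma>] by blast
  \<comment> \<open>With this \<open>\<eta>\<close>, the factor \<open>1 + \<eta>\<close> spends half of the decay rate, so that \<open>\<rho> = exp (- \<kappa> / 2)\<close>.\<close>
  define \<eta> where "\<eta> = exp (\<kappa> / 2) - 1"
  have \<eta>: "\<eta> > 0" using \<kappa> by (simp add: \<eta>_def)
  define \<rho> where "\<rho> = exp (- (\<kappa> / 2))"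
  have \<rho>: "(1 + \<eta>) * exp (- \<kappa>) = \<rho>"
    by (simp add: \<eta>_def \<rho>_def flip: exp_add)
  define q r where "q = (1 + \<eta>) * C" and "r = (1 + 1/\<eta>) * p"
  have qr: "0 \<le> q" "0 \<le> r" using \<eta> C p(1) by (auto simp: q_def r_def)
  define k1 k2 where "k1 = (2 * q + r) * (8 * d\<^sup>2)"
    and "k2 = 2 * \<sigma>\<^sup>2 * q * (CARD('m) * 4) + 2 * \<sigma>\<^sup>2 * r * (CARD('m) * 2)"
  have k12: "0 \<le> k1" "0 \<le> k2" using qr by (auto simp: k1_def k2_def)
  show ?thesis
  proof (rule that[of \<rho> k1 k2, OF _ _ k12])
    show "0 \<le> \<rho>" "\<rho> < 1" using \<kappa> by (simp_all add: \<rho>_def)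
    fix X :: "real \<Rightarrow> 'a \<Rightarrow> real^'n" and w :: "real \<Rightarrow> 'a \<Rightarrow> real^'w" and L t0 h :: real
    assume X: "ito_process M F m X (\<lambda>t \<omega>. A *v X t \<omega> + D *v w t \<omega>) \<Sigma>"
      and w: "time_measurable_process M w" "Linf_norm M w \<le> ennreal L" "0 \<le> L"
      and t0: "0 \<le> t0" and h: "1 \<le> h" "h \<le> 2"
    let ?V = "\<lambda>z. z \<bullet> (P *v z)"
    let ?b = "\<lambda>t \<omega>. A *v X t \<omega> + D *v w t \<omega>"
    have [measurable]: "X t0 \<in> borel_measurable M"
      using adapted_process_measurable[OF F _ t0] X by (auto simp: ito_process_def)
    have mm: "m u \<in> borel_measurable M" if "0 \<le> u" for u
      using adapted_process_measurable[OF F _ that] m by (auto simp: brownian_motion_def)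
    have [measurable]: "m t0 \<in> borel_measurable M" "m (t0 + h) \<in> borel_measurable M"
      using mm t0 h by auto
    have "continuous_on UNIV ?V"
      by (intro continuous_on_inner continuous_on_id continuous_on_matrix_vector_mult)
    then have V[measurable]: "?V \<in> borel_measurable borel"
      by (rule borel_measurable_continuous_onI)
    have Vnn: "0 \<le> ?V z" for z
      using P unfolding posdef_def by (cases "z = 0") (auto intro: less_imp_le)
    obtain g where [measurable]: "g \<in> borel_measurable M"
      and g: "AE \<omega> in M. ennreal (integral {t0..t0 + h} (\<lambda>s. (norm (m s \<omega> - m t0 \<omega>))\<^sup>2)) = g \<omega>"
        "(\<integral>\<^sup>+\<omega>. g \<omega> \<partial>M) \<le> ennreal (CARD('m) * (t0 + h - t0)\<^sup>2)"
      using h by (auto intro: brownian_time_integral[OF F m t0, of "t0 + h"])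
    have path: "AE \<omega> in M. \<forall>t\<ge>0. set_integrable lborel {0..t} (\<lambda>s. ?b s \<omega>) \<and>
        X t \<omega> = X 0 \<omega> + (LINT s:{0..t}|lborel. ?b s \<omega>) + \<Sigma> *v (m t \<omega> - m 0 \<omega>)"
      using X by (simp add: ito_process_def)
    have mc: "AE \<omega> in M. continuous_on {0..} (\<lambda>t. m t \<omega>)"
      using m by (simp add: brownian_motion_def)
    have "AE \<omega> in M. ennreal (?V (X (t0 + h) \<omega>)) \<le> ennreal \<rho> * ennreal (?V (X t0 \<omega>)) + ennreal (k1 * L\<^sup>2)
        + ennreal (2 * \<sigma>\<^sup>2 * q) * g \<omega>
        + ennreal (2 * \<sigma>\<^sup>2 * r) * ennreal ((norm (m (t0 + h) \<omega> - m t0 \<omega>))\<^sup>2)"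
      using path mc Linf_norm_path_bound[OF M w] g(1)
    proof eventually_elim
      case (elim \<omega>)
      let ?I = "integral {t0..t0 + h} (\<lambda>s. (norm (m s \<omega> - m t0 \<omega>))\<^sup>2)"
      have 1: "(\<lambda>s. ?b s \<omega>) integrable_on {0..t}"
        "X t \<omega> = X 0 \<omega> + integral {0..t} (\<lambda>s. ?b s \<omega>) + \<Sigma> *v (m t \<omega> - m 0 \<omega>)"
        if "0 \<le> t" for t
        using elim(1)[rule_format, OF that] set_borel_integral_eq_integral[of "{0..t}" "\<lambda>s. ?b s \<omega>"]
        by simp_all
      have "continuous_on {t0..t0 + h} (\<lambda>s. (norm (m s \<omega> - m t0 \<omega>))\<^sup>2)"
        by (intro continuous_on_power continuous_on_norm continuous_on_diff continuous_on_const
            continuous_on_subset[OF elim(2)]) (use t0 in auto)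
      then have I: "0 \<le> ?I"
        by (intro Henstock_Kurzweil_Integration.integral_nonneg integrable_continuous_interval) auto
      have "?V (X (t0 + h) \<omega>) \<le> (1 + \<eta>) * exp (- \<kappa>) * ?V (X t0 \<omega>) + (2 * q + r) * (8 * d\<^sup>2 * L\<^sup>2)
          + 2 * \<sigma>\<^sup>2 * q * ?I + 2 * \<sigma>\<^sup>2 * r * (norm (m (t0 + h) \<omega> - m t0 \<omega>))\<^sup>2"
        unfolding q_def r_def
        by (rule linear_path_step[where X="\<lambda>t. X t \<omega>" and w="\<lambda>t. w t \<omega>" and m="\<lambda>t. m t \<omega>",
            OF P C _ \<eta> w(3) _ _ key p(2) _ d(2) \<sigma>(2) t0 h elim(2) 1 elim(3)])
          (use \<kappa> p d \<sigma> in auto)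
      then have "ennreal (?V (X (t0 + h) \<omega>)) \<le> ennreal (\<rho> * ?V (X t0 \<omega>) + k1 * L\<^sup>2
          + 2 * \<sigma>\<^sup>2 * q * ?I + 2 * \<sigma>\<^sup>2 * r * (norm (m (t0 + h) \<omega> - m t0 \<omega>))\<^sup>2)"
        by (intro ennreal_leI) (simp add: \<rho> k1_def mult.assoc)
      also have "\<dots> = ennreal \<rho> * ennreal (?V (X t0 \<omega>)) + ennreal (k1 * L\<^sup>2)
        + ennreal (2 * \<sigma>\<^sup>2 * q) * ennreal ?I
        + ennreal (2 * \<sigma>\<^sup>2 * r) * ennreal ((norm (m (t0 + h) \<omega> - m t0 \<omega>))\<^sup>2)"
        using Vnn[of "X t0 \<omega>"] I qr k12 \<open>0 \<le> \<rho>\<close> by (simp add: ennreal_plus flip: ennreal_mult)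
      finally show ?case by (simp add: elim(4))
    qed
    then have "(\<integral>\<^sup>+\<omega>. ennreal (?V (X (t0 + h) \<omega>)) \<partial>M) \<le> (\<integral>\<^sup>+\<omega>. ennreal \<rho> * ennreal (?V (X t0 \<omega>)) + ennreal (k1 * L\<^sup>2)
        + ennreal (2 * \<sigma>\<^sup>2 * q) * g \<omega>
        + ennreal (2 * \<sigma>\<^sup>2 * r) * ennreal ((norm (m (t0 + h) \<omega> - m t0 \<omega>))\<^sup>2) \<partial>M)"
      by (rule nn_integral_mono_AE)
    also have "\<dots> = ennreal \<rho> * (\<integral>\<^sup>+\<omega>. ennreal (?V (X t0 \<omega>)) \<partial>M) + ennreal (k1 * L\<^sup>2)
        + ennreal (2 * \<sigma>\<^sup>2 * q) * (\<integral>\<^sup>+\<omega>. g \<omega> \<partial>M)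
        + ennreal (2 * \<sigma>\<^sup>2 * r) * (\<integral>\<^sup>+\<omega>. ennreal ((norm (m (t0 + h) \<omega> - m t0 \<omega>))\<^sup>2) \<partial>M)"
      by (simp add: nn_integral_add nn_integral_cmult emeasure_space_1)
    also have "\<dots> \<le> ennreal \<rho> * (\<integral>\<^sup>+\<omega>. ennreal (?V (X t0 \<omega>)) \<partial>M) + ennreal (k1 * L\<^sup>2)
        + ennreal (2 * \<sigma>\<^sup>2 * q) * ennreal (CARD('m) * 4)
        + ennreal (2 * \<sigma>\<^sup>2 * r) * ennreal (CARD('m) * 2)"
    proof (intro add_mono mult_left_mono order_refl)
      have "h\<^sup>2 \<le> 2\<^sup>2" using h by (intro power_mono) auto
      then have "ennreal (CARD('m) * (t0 + h - t0)\<^sup>2) \<le> ennreal (CARD('m) * 4)"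
        by (intro ennreal_leI mult_left_mono) auto
      with g(2) show "(\<integral>\<^sup>+\<omega>. g \<omega> \<partial>M) \<le> ennreal (CARD('m) * 4)" by (rule order_trans)
      have "(\<integral>\<^sup>+\<omega>. ennreal ((norm (m (t0 + h) \<omega> - m t0 \<omega>))\<^sup>2) \<partial>M) = ennreal (CARD('m) * (t0 + h - t0))"
        using h by (intro brownian_increment_second_moment[OF F m t0]) auto
      also have "\<dots> \<le> ennreal (CARD('m) * 2)"
        using h by (intro ennreal_leI mult_left_mono) auto
      finally show "(\<integral>\<^sup>+\<omega>. ennreal ((norm (m (t0 + h) \<omega> - m t0 \<omega>))\<^sup>2) \<partial>M) \<le> ennreal (CARD('m) * 2)" .
    qed auto
    also have "\<dots> = ennreal \<rho> * (\<integral>\<^sup>+\<omega>. ennreal (?V (X t0 \<omega>)) \<partial>M) + ennreal (k1 * L\<^sup>2 + k2)"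
      using qr k12 by (simp add: k2_def ennreal_plus add.assoc flip: ennreal_mult)
    finally show "(\<integral>\<^sup>+\<omega>. ennreal (?V (X (t0 + h) \<omega>)) \<partial>M)
         \<le> ennreal \<rho> * (\<integral>\<^sup>+\<omega>. ennreal (?V (X t0 \<omega>)) \<partial>M) + ennreal (k1 * L\<^sup>2 + k2)" .
  qed
qed

text \<open>
  The quadratic form of \<open>P\<close> is equivalent to the squared norm, so iterating the contraction on it
  bounds the second moment.
\<close>

lemma linear_ito_ultimately_bounded:
  fixes A P :: "real^'n^'n" and D :: "real^'w^'n" and \<Sigma> :: "real^'m^'n"
    and m :: "real \<Rightarrow> 'a \<Rightarrow> real^'m"
  assumes F: "complete_filtered_prob_space M F" and m: "brownian_motion M F m"
    and P: "posdef P" and \<alpha>: "\<alpha> > 0" and dec: "\<And>z. z \<bullet> (P *v (A *v z)) \<le> - \<alpha> * (norm z)\<^sup>2"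
  obtains c k where "0 \<le> c" "0 \<le> k"
    "\<And>X w. ito_process M F m X (\<lambda>t \<omega>. A *v X t \<omega> + D *v w t \<omega>) \<Sigma> \<Longrightarrow>
       time_measurable_process M w \<Longrightarrow> integrable M (\<lambda>\<omega>. (norm (X 0 \<omega>))\<^sup>2) \<Longrightarrow>
       Linf_norm M w < \<top> \<Longrightarrow>
       Limsup at_top (\<lambda>t. \<integral>\<^sup>+\<omega>. ennreal ((norm (X t \<omega>))\<^sup>2) \<partial>M)
         \<le> ennreal c * (Linf_norm M w)\<^sup>2 + ennreal k"
proof -
  obtain \<rho> k1 k2 where \<rho>: "0 \<le> \<rho>" "\<rho> < 1" and k: "0 \<le> k1" "0 \<le> k2"
    and step: "\<And>X w L t h. ito_process M F m X (\<lambda>t \<omega>. A *v X t \<omega> + D *v w t \<omega>) \<Sigma> \<Longrightarrow>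
       time_measurable_process M w \<Longrightarrow> Linf_norm M w \<le> ennreal L \<Longrightarrow> 0 \<le> L \<Longrightarrow>
       0 \<le> t \<Longrightarrow> 1 \<le> h \<Longrightarrow> h \<le> 2 \<Longrightarrow>
       (\<integral>\<^sup>+\<omega>. ennreal (X (t + h) \<omega> \<bullet> (P *v X (t + h) \<omega>)) \<partial>M)
         \<le> ennreal \<rho> * (\<integral>\<^sup>+\<omega>. ennreal (X t \<omega> \<bullet> (P *v X t \<omega>)) \<partial>M) + ennreal (k1 * L\<^sup>2 + k2)"
    using linear_ito_step[OF F m P \<alpha> dec, where D=D and \<Sigma>=\<Sigma>] by blast
  obtain e where e: "e > 0" "\<And>z. e * (norm z)\<^sup>2 \<le> z \<bullet> (P *v z)"
    using posdef_coercive[OF P] by blast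
  obtain p where p: "p > 0" "\<And>z. z \<bullet> (P *v z) \<le> p * (norm z)\<^sup>2"
    using quadratic_form_bounded[of P] by blast
  define c k where "c = k1 / (1 - \<rho>) / e" and "k = k2 / (1 - \<rho>) / e"
  have ck: "0 \<le> c" "0 \<le> k" using k \<rho> e by (auto simp: c_def k_def)
  show ?thesis
  proof (rule that[OF ck])
    fix X :: "real \<Rightarrow> 'a \<Rightarrow> real^'n" and w :: "real \<Rightarrow> 'a \<Rightarrow> real^'w"
    assume X: "ito_process M F m X (\<lambda>t \<omega>. A *v X t \<omega> + D *v w t \<omega>) \<Sigma>"
      and w: "time_measurable_process M w" and X0: "integrable M (\<lambda>\<omega>. (norm (X 0 \<omega>))\<^sup>2)"
      and Lfin: "Linf_norm M w < \<top>"
    define L where "L = enn2real (Linf_norm M w)"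
    have L: "Linf_norm M w = ennreal L" "0 \<le> L" using Lfin by (simp_all add: L_def)
    define f where "f t = (\<integral>\<^sup>+\<omega>. ennreal (X t \<omega> \<bullet> (P *v X t \<omega>)) \<partial>M)" for t
    define K where "K = k1 * L\<^sup>2 + k2"
    have Xm: "X t \<in> borel_measurable M" if "0 \<le> t" for t
      using adapted_process_measurable[OF F _ that] X by (auto simp: ito_process_def)
    have "f 0 \<le> (\<integral>\<^sup>+\<omega>. ennreal p * ennreal ((norm (X 0 \<omega>))\<^sup>2) \<partial>M)"
      unfolding f_def using p by (intro nn_integral_mono) (auto simp flip: ennreal_mult intro: ennreal_leI)
    also have "\<dots> = ennreal p * (\<integral>\<^sup>+\<omega>. ennreal ((norm (X 0 \<omega>))\<^sup>2) \<partial>M)"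
      using Xm[of 0] by (intro nn_integral_cmult) auto
    also have "\<dots> < \<top>"
      using integrableD(2)[OF X0] by (simp add: ennreal_mult_less_top less_top)
    finally have f0: "f 0 < \<top>" .
    have fstep: "f (t + h) \<le> ennreal \<rho> * f t + ennreal K" if "0 \<le> t" "1 \<le> h" "h \<le> 2" for t h
      unfolding f_def K_def using step[OF X w _ L(2) that] L(1) by simp
    have "0 \<le> K" using k by (simp add: K_def)
    obtain g where g: "(g \<longlongrightarrow> K / (1 - \<rho>)) at_top" "\<And>t. 1 \<le> t \<Longrightarrow> f t \<le> ennreal (g t)"
      using contraction_steps_bound[OF f0 \<rho> \<open>0 \<le> K\<close> fstep] by blast
    have "(\<integral>\<^sup>+\<omega>. ennreal ((norm (X t \<omega>))\<^sup>2) \<partial>M) \<le> ennreal (g t / e)" if "1 \<le> t" for t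
    proof -
      have "(norm (X t \<omega>))\<^sup>2 \<le> 1 / e * (X t \<omega> \<bullet> (P *v X t \<omega>))" for \<omega>
        using e(2)[of "X t \<omega>"] e(1) by (simp add: field_simps)
      then have "(\<integral>\<^sup>+\<omega>. ennreal ((norm (X t \<omega>))\<^sup>2) \<partial>M)
          \<le> (\<integral>\<^sup>+\<omega>. ennreal (1 / e) * ennreal (X t \<omega> \<bullet> (P *v X t \<omega>)) \<partial>M)"
        using e(1) by (intro nn_integral_mono) (auto simp flip: ennreal_mult' intro: ennreal_leI)
      also have "\<dots> = ennreal (1 / e) * f t"
      proof -
        have "continuous_on UNIV (\<lambda>z. z \<bullet> (P *v z))"
          by (intro continuous_on_inner continuous_on_id continuous_on_matrix_vector_mult)
        then have [measurable]: "(\<lambda>z. z \<bullet> (P *v z)) \<in> borel_measurable borel"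
          by (rule borel_measurable_continuous_onI)
        have [measurable]: "X t \<in> borel_measurable M" using Xm that by simp
        show ?thesis unfolding f_def by (rule nn_integral_cmult) measurable
      qed
      also have "\<dots> \<le> ennreal (1 / e) * ennreal (g t)" by (intro mult_left_mono g(2) that) auto
      also have "\<dots> = ennreal (g t / e)" using e(1) by (simp flip: ennreal_mult')
      finally show ?thesis .
    qed
    then have "Limsup at_top (\<lambda>t. \<integral>\<^sup>+\<omega>. ennreal ((norm (X t \<omega>))\<^sup>2) \<partial>M) \<le> Limsup at_top (\<lambda>t. ennreal (g t / e))"
      by (intro Limsup_mono eventually_at_top_linorderI[of 1])
    also have "\<dots> = ennreal (K / (1 - \<rho>) / e)"
      by (intro lim_imp_Limsup tendsto_ennrealI tendsto_divide g(1) tendsto_const) (use e(1) in auto)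
    also have "K / (1 - \<rho>) / e = c * L\<^sup>2 + k"
      by (simp add: K_def c_def k_def add_divide_distrib)
    also have "ennreal (c * L\<^sup>2 + k) = ennreal c * (Linf_norm M w)\<^sup>2 + ennreal k"
      using ck L by (simp add: ennreal_plus ennreal_mult ennreal_power)
    finally show "Limsup at_top (\<lambda>t. \<integral>\<^sup>+\<omega>. ennreal ((norm (X t \<omega>))\<^sup>2) \<partial>M)
         \<le> ennreal c * (Linf_norm M w)\<^sup>2 + ennreal k" .
  qed
qed

section \<open>The closed loop\<close>

theorem theorem1:
  fixes A :: "real^'x^'x" and B :: "real^'u^'x" and D :: "real^'w^'x"
    and Ay :: "real^'x^'y" and E\<^sub>x :: "real^'m^'x" and E\<^sub>y :: "real^'d^'y"
    and \<Gamma>0 \<Gamma>1 :: "real^'x^'x" and \<gamma>W \<gamma>star :: real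
    and S W T :: "real^'x^'x" and Bs :: "real^'y^'x" and Cs :: "real^'x^'u"
    and Df :: "real^'y^'u" and N :: "real^'m^'m"
    and Af :: "real^'x^'x" and Bf :: "real^'y^'x" and Cf :: "real^'x^'u"
    and M :: "'a measure" and F :: "real \<Rightarrow> 'a measure"
    and m :: "real \<Rightarrow> 'a \<Rightarrow> real^'m" and \<delta> :: "real \<Rightarrow> 'a \<Rightarrow> real^'d"
  assumes "posdef \<Gamma>0" and "posdef \<Gamma>1"
    and "0 \<le> \<gamma>star" and "\<gamma>W = sqrt \<gamma>star"
    and "sdp_feasible A B D Ay E\<^sub>x \<Gamma>0 \<Gamma>1 \<gamma>star S W Bs Cs Df N"
    and "posdef T"
    and "Af = controller_Af A B Ay S W Bs Cs Df T"
    and "Bf = controller_Bf B S W Bs Df T"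
    and "Cf = controller_Cf Ay S Cs Df T"
    and "complete_filtered_prob_space M F"
    and "brownian_motion M F m" and "brownian_motion M F \<delta>"
  shows "(\<exists>(P :: real^('x + 'x)^('x + 'x)) \<alpha> \<beta>.
            posdef P \<and> \<alpha> > 0 \<and> \<beta> > 0 \<and>
            (\<forall>x0 w x xf.
               closed_loop_trajectory M F m A B D Ay E\<^sub>x E\<^sub>y Af Bf Cf Df x0 w x xf \<longrightarrow>
               (\<forall>t\<ge>0. \<forall>\<omega>\<in>space M.
                  expected_differential (\<lambda>X. 1/2 * (X \<bullet> (P *v X)))
                    (vstack (x t \<omega>) (xf t \<omega>))
                    (closed_loop_drift A B D Ay E\<^sub>y Af Bf Cf Df (x t \<omega>) (xf t \<omega>) (w t \<omega>))
                    (closed_loop_diffusion E\<^sub>x)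
                  \<le> - \<alpha> * (norm (vstack (x t \<omega>) (xf t \<omega>)))\<^sup>2 + \<beta> * (norm (w t \<omega>))\<^sup>2 + trace N)))
       \<and> (\<exists>c1 c2 :: real.
            c1 > 0 \<and> c2 > 0 \<and>
            (\<forall>x0 w x xf.
               closed_loop_trajectory M F m A B D Ay E\<^sub>x E\<^sub>y Af Bf Cf Df x0 w x xf \<longrightarrow>
               Linf_norm M w < \<top> \<longrightarrow>
               Limsup at_top
                 (\<lambda>t. \<integral>\<^sup>+\<omega>. ennreal ((norm (vstack (x t \<omega>) (xf t \<omega>)))\<^sup>2) \<partial>M)
               \<le> (ennreal c1 * (Linf_norm M w)\<^sup>2 + ennreal (trace N)) / ennreal c2))"
proof -
  note feas = assms(5) and T = assms(6) and F = assms(10) and m = assms(11)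
  let ?drift = "closed_loop_drift A B D Ay E\<^sub>y Af Bf Cf Df"
  let ?\<Sigma> = "closed_loop_diffusion E\<^sub>x :: real^'m^('x + 'x)"
  have trN: "0 < trace N"
    using sdp_feasible_posdef(1)[OF feas] by (rule posdef_trace_pos)
  obtain P :: "real^('x + 'x)^('x + 'x)" and \<alpha> \<beta> where P: "posdef P" and \<alpha>: "\<alpha> > 0" and \<beta>: "\<beta> > 0"
    and diss': "\<And>(E\<^sub>y :: real^'d^'y) x xf w. vstack x xf \<bullet> (P *v closed_loop_drift A B D Ay E\<^sub>y Af Bf Cf Df x xf w)
      \<le> - \<alpha> * (norm (vstack x xf))\<^sup>2 + \<beta> * (norm w)\<^sup>2"
    by (rule closed_loop_lyapunov[OF feas T, folded assms(7-9)], rule that)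
  note diss = diss'[of _ _ E\<^sub>y]
  define \<nu> where "\<nu> = (\<Sum>k\<in>UNIV. column k ?\<Sigma> \<bullet> (P *v column k ?\<Sigma>))"
  have \<nu>: "0 \<le> \<nu>"
    unfolding \<nu>_def
  proof (rule sum_nonneg)
    fix k
    show "0 \<le> column k ?\<Sigma> \<bullet> (P *v column k ?\<Sigma>)"
      using P unfolding posdef_def by (cases "column k ?\<Sigma> = 0") (auto intro: less_imp_le)
  qed
  \<comment> \<open>The scaling that brings the contribution \<open>c \<nu> / 2\<close> of the noise below \<open>trace N\<close>.\<close>
  define c where "c = trace N / (\<nu> + 1)"
  have c: "c > 0" using trN \<nu> by (simp add: c_def)
  have c\<nu>: "1/2 * (c * \<nu>) \<le> trace N"
    using trN \<nu> by (simp add: c_def field_simps)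
  have cP: "posdef (c *\<^sub>R P)" using c P by (rule posdef_scaleR)
  have ineq: "expected_differential (\<lambda>X. 1/2 * (X \<bullet> ((c *\<^sub>R P) *v X))) (vstack x xf) (?drift x xf w) ?\<Sigma>
      \<le> - (c * \<alpha>) * (norm (vstack x xf))\<^sup>2 + (c * \<beta>) * (norm w)\<^sup>2 + trace N" for x xf w
  proof -
    have "expected_differential (\<lambda>X. 1/2 * (X \<bullet> ((c *\<^sub>R P) *v X))) (vstack x xf) (?drift x xf w) ?\<Sigma>
        = vstack x xf \<bullet> ((c *\<^sub>R P) *v ?drift x xf w)
          + 1/2 * (\<Sum>k\<in>UNIV. column k ?\<Sigma> \<bullet> ((c *\<^sub>R P) *v column k ?\<Sigma>))"
      by (rule expected_differential_quadratic) (use cP in \<open>simp add: posdef_def\<close>)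
    also have "\<dots> = c * (vstack x xf \<bullet> (P *v ?drift x xf w)) + 1/2 * (c * \<nu>)"
      by (simp add: \<nu>_def sum_distrib_left flip: scaleR_matrix_vector_assoc)
    also have "\<dots> \<le> c * (- \<alpha> * (norm (vstack x xf))\<^sup>2 + \<beta> * (norm w)\<^sup>2) + trace N"
      using c by (intro add_mono mult_left_mono diss c\<nu>) auto
    finally show ?thesis by (simp add: algebra_simps)
  qed
  have 1: "\<exists>(P :: real^('x + 'x)^('x + 'x)) \<alpha> \<beta>.
            posdef P \<and> \<alpha> > 0 \<and> \<beta> > 0 \<and>
            (\<forall>x0 w x xf.
               closed_loop_trajectory M F m A B D Ay E\<^sub>x E\<^sub>y Af Bf Cf Df x0 w x xf \<longrightarrow>
               (\<forall>t\<ge>0. \<forall>\<omega>\<in>space M.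
                  expected_differential (\<lambda>X. 1/2 * (X \<bullet> (P *v X)))
                    (vstack (x t \<omega>) (xf t \<omega>)) (?drift (x t \<omega>) (xf t \<omega>) (w t \<omega>)) ?\<Sigma>
                  \<le> - \<alpha> * (norm (vstack (x t \<omega>) (xf t \<omega>)))\<^sup>2 + \<beta> * (norm (w t \<omega>))\<^sup>2 + trace N))"
    using cP c \<alpha> \<beta> ineq by (intro exI[of _ "c *\<^sub>R P"] exI[of _ "c * \<alpha>"] exI[of _ "c * \<beta>"]) auto
  let ?Ac = "block2 (A + B ** Df ** Ay) (B ** Cf) (Bf ** Ay) Af"
  let ?Dc = "vstack D 0 :: real^'w^('x + 'x)"
  have dec: "z \<bullet> (P *v (?Ac *v z)) \<le> - \<alpha> * (norm z)\<^sup>2" for z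
  proof -
    obtain x xf where "z = vstack x xf" by (rule vstack_exhaust)
    then show ?thesis using diss[of x xf 0] by (simp add: closed_loop_drift_eq)
  qed
  obtain k1 k2 where k: "0 \<le> k1" "0 \<le> k2"
    and bound: "\<And>X w. ito_process M F m X (\<lambda>t \<omega>. ?Ac *v X t \<omega> + ?Dc *v w t \<omega>) ?\<Sigma> \<Longrightarrow>
       time_measurable_process M w \<Longrightarrow> integrable M (\<lambda>\<omega>. (norm (X 0 \<omega>))\<^sup>2) \<Longrightarrow>
       Linf_norm M w < \<top> \<Longrightarrow>
       Limsup at_top (\<lambda>t. \<integral>\<^sup>+\<omega>. ennreal ((norm (X t \<omega>))\<^sup>2) \<partial>M)
         \<le> ennreal k1 * (Linf_norm M w)\<^sup>2 + ennreal k2"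
    using linear_ito_ultimately_bounded[OF F m P \<alpha> dec, where D="?Dc" and \<Sigma>="?\<Sigma>"] by blast
  \<comment> \<open>The constants are scaled so that \<open>trace N / c2\<close> dominates the noise level \<open>k2\<close>.\<close>
  define c2 where "c2 = trace N / (k2 + 1)"
  define c1 where "c1 = k1 * c2 + 1"
  have c2: "c2 > 0" using trN k by (simp add: c2_def)
  have c1: "c1 > 0" using k c2 by (simp add: c1_def add_nonneg_pos)
  have 2: "Limsup at_top (\<lambda>t. \<integral>\<^sup>+\<omega>. ennreal ((norm (vstack (x t \<omega>) (xf t \<omega>)))\<^sup>2) \<partial>M)
      \<le> (ennreal c1 * (Linf_norm M w)\<^sup>2 + ennreal (trace N)) / ennreal c2"
    if tr: "closed_loop_trajectory M F m A B D Ay E\<^sub>x E\<^sub>y Af Bf Cf Df x0 w x xf"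
      and L: "Linf_norm M w < \<top>" for x0 w x xf
  proof -
    define l where "l = enn2real (Linf_norm M w)"
    have l: "Linf_norm M w = ennreal l" "0 \<le> l" using L by (simp_all add: l_def)
    have "Limsup at_top (\<lambda>t. \<integral>\<^sup>+\<omega>. ennreal ((norm (vstack (x t \<omega>) (xf t \<omega>)))\<^sup>2) \<partial>M)
        \<le> ennreal k1 * (Linf_norm M w)\<^sup>2 + ennreal k2"
      using tr L by (intro bound) (auto simp: closed_loop_trajectory_def closed_loop_drift_eq)
    also have "\<dots> = ennreal (k1 * l\<^sup>2 + k2)"
      using k l by (simp add: ennreal_plus ennreal_mult ennreal_power)
    also have "\<dots> \<le> ennreal ((c1 * l\<^sup>2 + trace N) / c2)"
    proof (rule ennreal_leI)
      have "k2 * c2 \<le> trace N" using trN k by (simp add: c2_def field_simps)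
      then have "(k1 * l\<^sup>2 + k2) * c2 \<le> c1 * l\<^sup>2 + trace N"
        by (simp add: c1_def algebra_simps add_increasing2)
      then show "k1 * l\<^sup>2 + k2 \<le> (c1 * l\<^sup>2 + trace N) / c2"
        using c2 by (simp add: pos_le_divide_eq)
    qed
    also have "\<dots> = (ennreal c1 * (Linf_norm M w)\<^sup>2 + ennreal (trace N)) / ennreal c2"
      using c1 c2 l trN by (simp add: ennreal_plus ennreal_mult ennreal_power flip: divide_ennreal)
    finally show ?thesis .
  qed
  show ?thesis
    using 1 2 c1 c2 by blast
qed

end
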